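(* Let $\mathfrak{g}$ be a six-dimensional non-nilpotent almost abelian Lie algebra which admits no Kähler structure. Then $\mathfrak{g}$ admits a balanced Hermitian structure $(J,g)$ if and only if it is isomorphic to one of the following Lie algebras (for some real values of the parameters satisfying the stated conditions): \begin{itemize} \item $\mathfrak{b}_1=(f^{16},pf^{26},pf^{36},-pf^{46},-pf^{56},0)$, $p\neq 0$; \item $\mathfrak{b}_2=(f^{16},f^{36},0,f^{56},0,0)$; \item $\mathfrak{b}_3=(pf^{16},qf^{26},qf^{36},-qf^{46}+f^{56},-f^{46}-qf^{56},0)$, $pq\neq 0$; \item $\mathfrak{b}_4=(pf^{16},qf^{26}+f^{36},-f^{26}+qf^{36},-qf^{46}+sf^{56},-sf^{46}-qf^{56},0)$, $pqs\neq 0$; \item $\mathfrak{b}_5=(pf^{16},f^{36}-f^{46},-f^{26}-f^{56},f^{56},-f^{46},0)$, $p\neq 0$; \item $\mathfrak{b}_6=(f^{16},f^{26},-f^{36},-f^{46},0,0)$; \item $\mathfrak{b}_7=(f^{16},f^{26},-f^{36}+rf^{46},-rf^{36}-f^{46},0,0)$, $r\neq 0$; \item $\mathfrak{b}_8=(pf^{16}+f^{26},-f^{16}+pf^{26},-pf^{36}+rf^{46},-rf^{36}-pf^{46},0,0)$, $pr\neq 0$; \item $\mathfrak{b}_9=(f^{26}-f^{36},-f^{16}-f^{46},f^{46},-f^{36},0,0)$. \end{itemize} Among these, only $\mathfrak{b}_6,\mathfrak{b}_7,\mathfrak{b}_8$ and $\mathfrak{b}_9$ are unimodular.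
   Context: A (real) Lie algebra is almost abelian if it contains an abelian ideal of codimension one; it is unimodular if $\operatorname{tr}\operatorname{ad}_X=0$ for all $X$. A Hermitian structure $(J,g)$ on a Lie algebra is an integrable complex structure $J$ together with an inner product $g$ with $g(J\cdot,J\cdot)=g$; with $\omega=g(J\cdot,\cdot)$ and $d$ the Chevalley-Eilenberg differential, in real dimension six it is balanced if $d\omega^{2}=0$ and Kähler if $d\omega=0$. "Non-Kähler" for a Lie algebra means that it admits no Kähler Hermitian structure. Notation: writing $\mathfrak{g}=(\alpha_1,\ldots,\alpha_6)$ with $\alpha_k$ 2-forms means that $\mathfrak{g}$ has a basis $\{f_1,\ldots,f_6\}$ whose dual basis $\{f^1,\ldots,f^6\}$ satisfies $df^k=\alpha_k$, where $d\alpha(X,Y)=-\alpha([X,Y])$ and $f^{ij}=f^i\wedge f^j$. *)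

theory Defs
  imports "HOL-Analysis.Analysis"
begin

section \<open>Real Lie algebras\<close>

text \<open>A Lie algebra is given by its bracket on a (finite-dimensional) real vector space, which is
  the whole type.\<close>

definition lie_algebra :: "('a::real_vector \<Rightarrow> 'a \<Rightarrow> 'a) \<Rightarrow> bool" where
  "lie_algebra br \<longleftrightarrow> bilinear br \<and> (\<forall>x. br x x = 0) \<and>
     (\<forall>x y z. br x (br y z) + br y (br z x) + br z (br x y) = 0)"

definition lie_isomorphic ::
  "('a::real_vector \<Rightarrow> 'a \<Rightarrow> 'a) \<Rightarrow> ('b::real_vector \<Rightarrow> 'b \<Rightarrow> 'b) \<Rightarrow> bool" where
  "lie_isomorphic br br' \<longleftrightarrow>
     (\<exists>\<phi>. linear \<phi> \<and> bij \<phi> \<and> (\<forall>x y. \<phi> (br x y) = br' (\<phi> x) (\<phi> y)))"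

definition lie_ideal :: "('a::real_vector \<Rightarrow> 'a \<Rightarrow> 'a) \<Rightarrow> 'a set \<Rightarrow> bool" where
  "lie_ideal br I \<longleftrightarrow> subspace I \<and> (\<forall>x. \<forall>y\<in>I. br x y \<in> I)"

definition almost_abelian :: "('a::real_vector \<Rightarrow> 'a \<Rightarrow> 'a) \<Rightarrow> bool" where
  "almost_abelian br \<longleftrightarrow>
     (\<exists>I. lie_ideal br I \<and> (\<forall>x\<in>I. \<forall>y\<in>I. br x y = 0) \<and> dim I + 1 = dim (UNIV :: 'a set))"

primrec lower_central_series :: "('a::real_vector \<Rightarrow> 'a \<Rightarrow> 'a) \<Rightarrow> nat \<Rightarrow> 'a set" where
  "lower_central_series br 0 = UNIV"
| "lower_central_series br (Suc k) = span {br x y | x y. y \<in> lower_central_series br k}"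

definition nilpotent_lie :: "('a::real_vector \<Rightarrow> 'a \<Rightarrow> 'a) \<Rightarrow> bool" where
  "nilpotent_lie br \<longleftrightarrow> (\<exists>k. lower_central_series br k = {0})"

definition unimodular :: "(real^'n \<Rightarrow> real^'n \<Rightarrow> real^'n) \<Rightarrow> bool" where
  "unimodular br \<longleftrightarrow> (\<forall>x. trace (matrix (br x)) = 0)"

section \<open>Forms\<close>

text \<open>A \<open>k\<close>-form is represented by its values on lists of \<open>k\<close> vectors; its values on lists of any
  other length are irrelevant. The wedge product is normalised so that
  \<open>(\<alpha> \<and> \<beta>)(X, Y) = \<alpha>(X) \<beta>(Y) - \<alpha>(Y) \<beta>(X)\<close> for 1-forms.\<close>

type_synonym 'a form = "'a list \<Rightarrow> real"

definition wedge :: "nat \<Rightarrow> nat \<Rightarrow> 'a form \<Rightarrow> 'a form \<Rightarrow> 'a form" where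
  "wedge k l \<alpha> \<beta> xs =
     (\<Sum>\<sigma> | \<sigma> permutes {..<k + l}. of_int (sign \<sigma>) *
        \<alpha> (map (\<lambda>i. xs ! \<sigma> i) [0..<k]) * \<beta> (map (\<lambda>i. xs ! \<sigma> i) [k..<k + l]))
     / (fact k * fact l)"

text \<open>The Chevalley--Eilenberg differential
  \<open>d\<alpha>(X\<^sub>0,\<dots>,X\<^sub>k) = \<Sum>\<^bsub>i<j\<^esub> (-1)\<^bsup>i+j\<^esup> \<alpha>([X\<^sub>i,X\<^sub>j], X\<^sub>0, \<dots>, X\<^sub>k)\<close>, where \<open>X\<^sub>i\<close> and \<open>X\<^sub>j\<close> are left out
  of the remaining arguments; for a 1-form this is \<open>d\<alpha>(X, Y) = -\<alpha>([X, Y])\<close>.\<close>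

definition ce_d :: "('a \<Rightarrow> 'a \<Rightarrow> 'a) \<Rightarrow> 'a form \<Rightarrow> 'a form" where
  "ce_d br \<alpha> xs =
     (\<Sum>j<length xs. \<Sum>i<j. (-1) ^ (i + j) * \<alpha> (br (xs ! i) (xs ! j) # nths xs (- {i, j})))"

section \<open>Hermitian structures\<close>

definition complex_structure :: "('a::real_vector \<Rightarrow> 'a \<Rightarrow> 'a) \<Rightarrow> ('a \<Rightarrow> 'a) \<Rightarrow> bool" where
  "complex_structure br J \<longleftrightarrow> linear J \<and> (\<forall>x. J (J x) = - x) \<and>
     (\<forall>x y. br (J x) (J y) - J (br (J x) y) - J (br x (J y)) - br x y = 0)"

definition inner_product :: "('a::real_vector \<Rightarrow> 'a \<Rightarrow> real) \<Rightarrow> bool" where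
  "inner_product g \<longleftrightarrow> bilinear g \<and> (\<forall>x y. g x y = g y x) \<and> (\<forall>x. x \<noteq> 0 \<longrightarrow> g x x > 0)"

definition hermitian_structure ::
  "('a::real_vector \<Rightarrow> 'a \<Rightarrow> 'a) \<Rightarrow> ('a \<Rightarrow> 'a) \<Rightarrow> ('a \<Rightarrow> 'a \<Rightarrow> real) \<Rightarrow> bool" where
  "hermitian_structure br J g \<longleftrightarrow>
     complex_structure br J \<and> inner_product g \<and> (\<forall>x y. g (J x) (J y) = g x y)"

definition fundamental_form :: "('a \<Rightarrow> 'a) \<Rightarrow> ('a \<Rightarrow> 'a \<Rightarrow> real) \<Rightarrow> 'a form" where
  "fundamental_form J g xs = g (J (xs ! 0)) (xs ! 1)"

definition kahler_structure ::
  "('a::real_vector \<Rightarrow> 'a \<Rightarrow> 'a) \<Rightarrow> ('a \<Rightarrow> 'a) \<Rightarrow> ('a \<Rightarrow> 'a \<Rightarrow> real) \<Rightarrow> bool" where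
  "kahler_structure br J g \<longleftrightarrow> hermitian_structure br J g \<and>
     (\<forall>xs. length xs = 3 \<longrightarrow> ce_d br (fundamental_form J g) xs = 0)"

text \<open>This is the balanced condition \<open>d\<omega>\<^sup>2 = 0\<close> of real dimension six
  (\<open>d\<omega>\<^bsup>n-1\<^esup> = 0\<close> with \<open>n = 3\<close>).\<close>

definition balanced_structure ::
  "('a::real_vector \<Rightarrow> 'a \<Rightarrow> 'a) \<Rightarrow> ('a \<Rightarrow> 'a) \<Rightarrow> ('a \<Rightarrow> 'a \<Rightarrow> real) \<Rightarrow> bool" where
  "balanced_structure br J g \<longleftrightarrow> hermitian_structure br J g \<and>
     (\<forall>xs. length xs = 5 \<longrightarrow>
        ce_d br (wedge 2 2 (fundamental_form J g) (fundamental_form J g)) xs = 0)"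

section \<open>Lie algebras given by structure equations\<close>

definition dual_basis :: "'n \<Rightarrow> (real^'n) form" where
  "dual_basis i xs = (xs ! 0) $ i"

text \<open>The notation \<open>(\<alpha>\<^sub>1, \<dots>, \<alpha>\<^sub>6)\<close>, realised on the standard basis \<open>f\<^sub>i\<close> of \<open>real^6\<close>: the argument
  sends the values \<open>f\<^bsup>ij\<^esup>(X, Y)\<close> to the list of values \<open>\<alpha>\<^sub>k(X, Y)\<close>, and \<open>df\<^sup>k = \<alpha>\<^sub>k\<close> says that the
  \<open>k\<close>-th coordinate of \<open>[X, Y]\<close> is \<open>-\<alpha>\<^sub>k(X, Y)\<close>; see \<open>ce_d_dual_basis\<close>. In the index type \<open>6\<close> the
  numeral \<open>6\<close> equals \<open>0\<close>, and \<open>1, \<dots>, 6\<close> are its six distinct elements.\<close>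

definition lie_of_eqs :: "((6 \<Rightarrow> 6 \<Rightarrow> real) \<Rightarrow> real list) \<Rightarrow> real^6 \<Rightarrow> real^6 \<Rightarrow> real^6" where
  "lie_of_eqs \<alpha> X Y =
     vector (map uminus (\<alpha> (\<lambda>i j. wedge 1 1 (dual_basis i) (dual_basis j) [X, Y])))"

lemma vector_6:
  "(vector [a, b, c, d, e, f] :: ('a::zero)^6) $ 1 = a"
  "(vector [a, b, c, d, e, f] :: ('a::zero)^6) $ 2 = b"
  "(vector [a, b, c, d, e, f] :: ('a::zero)^6) $ 3 = c"
  "(vector [a, b, c, d, e, f] :: ('a::zero)^6) $ 4 = d"
  "(vector [a, b, c, d, e, f] :: ('a::zero)^6) $ 5 = e"
  "(vector [a, b, c, d, e, f] :: ('a::zero)^6) $ 6 = f"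
  unfolding vector_def by simp_all

lemma forall_6: "(\<forall>i::6. P i) \<longleftrightarrow> P 1 \<and> P 2 \<and> P 3 \<and> P 4 \<and> P 5 \<and> P 6"
proof -
  have "(UNIV :: 6 set) = {1, 2, 3, 4, 5, 6}"
    by (rule sym, rule card_subset_eq) simp_all
  then show ?thesis
    by (metis (no_types, lifting) UNIV_I insert_iff singletonD)
qed

lemma wedge_dual_basis:
  "wedge 1 1 (dual_basis i) (dual_basis j) [X, Y] = X $ i * Y $ j - Y $ i * X $ j"
proof -
  have P: "{\<sigma>. \<sigma> permutes {..<Suc (Suc 0)}} = {id, Transposition.transpose 0 1}"
    using permutes_doubleton_iff[of _ "0::nat" 1] by (auto simp: lessThan_Suc insert_commute)
  have "id \<noteq> Transposition.transpose 0 (1::nat)"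
    by (metis id_apply transpose_apply_first zero_neq_one)
  then show ?thesis
    by (simp add: wedge_def P dual_basis_def sign_swap_id)
qed

lemma lie_of_eqs_eq:
  "lie_of_eqs \<alpha> X Y = vector (map uminus (\<alpha> (\<lambda>i j. X $ i * Y $ j - Y $ i * X $ j)))"
  unfolding lie_of_eqs_def wedge_dual_basis ..

lemma ce_d_dual_basis:
  assumes "\<alpha> (\<lambda>i j. wedge 1 1 (dual_basis i) (dual_basis j) [X, Y]) = [a1, a2, a3, a4, a5, a6]"
  shows "ce_d (lie_of_eqs \<alpha>) (dual_basis 1) [X, Y] = a1"
    "ce_d (lie_of_eqs \<alpha>) (dual_basis 2) [X, Y] = a2"
    "ce_d (lie_of_eqs \<alpha>) (dual_basis 3) [X, Y] = a3"
    "ce_d (lie_of_eqs \<alpha>) (dual_basis 4) [X, Y] = a4"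
    "ce_d (lie_of_eqs \<alpha>) (dual_basis 5) [X, Y] = a5"
    "ce_d (lie_of_eqs \<alpha>) (dual_basis 6) [X, Y] = a6"
  using assms by (simp_all add: ce_d_def dual_basis_def lie_of_eqs_def vector_6)

definition alg_b1 :: "real \<Rightarrow> real^6 \<Rightarrow> real^6 \<Rightarrow> real^6" where
  "alg_b1 p = lie_of_eqs (\<lambda>f. [f 1 6, p * f 2 6, p * f 3 6, - p * f 4 6, - p * f 5 6, 0])"

definition alg_b2 :: "real^6 \<Rightarrow> real^6 \<Rightarrow> real^6" where
  "alg_b2 = lie_of_eqs (\<lambda>f. [f 1 6, f 3 6, 0, f 5 6, 0, 0])"

definition alg_b3 :: "real \<Rightarrow> real \<Rightarrow> real^6 \<Rightarrow> real^6 \<Rightarrow> real^6" where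
  "alg_b3 p q = lie_of_eqs (\<lambda>f. [p * f 1 6, q * f 2 6, q * f 3 6,
     - q * f 4 6 + f 5 6, - f 4 6 - q * f 5 6, 0])"

definition alg_b4 :: "real \<Rightarrow> real \<Rightarrow> real \<Rightarrow> real^6 \<Rightarrow> real^6 \<Rightarrow> real^6" where
  "alg_b4 p q s = lie_of_eqs (\<lambda>f. [p * f 1 6, q * f 2 6 + f 3 6, - f 2 6 + q * f 3 6,
     - q * f 4 6 + s * f 5 6, - s * f 4 6 - q * f 5 6, 0])"

definition alg_b5 :: "real \<Rightarrow> real^6 \<Rightarrow> real^6 \<Rightarrow> real^6" where
  "alg_b5 p = lie_of_eqs (\<lambda>f. [p * f 1 6, f 3 6 - f 4 6, - f 2 6 - f 5 6, f 5 6, - f 4 6, 0])"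

definition alg_b6 :: "real^6 \<Rightarrow> real^6 \<Rightarrow> real^6" where
  "alg_b6 = lie_of_eqs (\<lambda>f. [f 1 6, f 2 6, - f 3 6, - f 4 6, 0, 0])"

definition alg_b7 :: "real \<Rightarrow> real^6 \<Rightarrow> real^6 \<Rightarrow> real^6" where
  "alg_b7 r = lie_of_eqs (\<lambda>f. [f 1 6, f 2 6, - f 3 6 + r * f 4 6, - r * f 3 6 - f 4 6, 0, 0])"

definition alg_b8 :: "real \<Rightarrow> real \<Rightarrow> real^6 \<Rightarrow> real^6 \<Rightarrow> real^6" where
  "alg_b8 p r = lie_of_eqs (\<lambda>f. [p * f 1 6 + f 2 6, - f 1 6 + p * f 2 6,
     - p * f 3 6 + r * f 4 6, - r * f 3 6 - p * f 4 6, 0, 0])"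

definition alg_b9 :: "real^6 \<Rightarrow> real^6 \<Rightarrow> real^6" where
  "alg_b9 = lie_of_eqs (\<lambda>f. [f 2 6 - f 3 6, - f 1 6 - f 4 6, f 4 6, - f 3 6, 0, 0])"

lemma lie_algebra_alg_b:
  shows "lie_algebra (alg_b1 p)" "lie_algebra alg_b2" "lie_algebra (alg_b3 p q)"
    "lie_algebra (alg_b4 p q s)" "lie_algebra (alg_b5 p)" "lie_algebra alg_b6"
    "lie_algebra (alg_b7 r)" "lie_algebra (alg_b8 p r)" "lie_algebra alg_b9"
  unfolding alg_b1_def alg_b2_def alg_b3_def alg_b4_def alg_b5_def alg_b6_def alg_b7_def
    alg_b8_def alg_b9_def lie_algebra_def bilinear_def
  by (auto intro!: linearI simp: lie_of_eqs_eq vec_eq_iff forall_6 vector_6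
      algebra_simps)

end

theory Submission
  imports Defs
begin

text \<open>Let \<open>(J, g)\<close> be a Hermitian structure and \<open>\<nn>\<close> an abelian ideal of codimension one. Take \<open>e\<close>
  orthogonal to \<open>\<nn>\<close>; then \<open>J e \<in> \<nn>\<close>, and \<open>\<nn>\<^sub>1 = \<nn> \<inter> J \<nn>\<close> is the orthogonal complement of the plane
  spanned by \<open>e\<close> and \<open>J e\<close>. Integrability says that \<open>ad e\<close> preserves \<open>\<nn>\<^sub>1\<close> and is complex linear on it, and
  \<open>d\<omega>\<^sup>2 = 0\<close> says that \<open>[e, J e] = a J e\<close> and that \<open>ad e\<close> has zero real trace on \<open>\<nn>\<^sub>1\<close>. So the algebra is
  determined by \<open>a\<close> and a complex \<open>2 \<times> 2\<close> matrix with \<open>Re tr = 0\<close>, up to conjugation and a common real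
  scaling, and conversely all such algebras are balanced. The Jordan form of the matrix gives the
  list: a diagonal matrix with imaginary eigenvalues yields a Kaehler structure, and a nilpotent
  matrix with \<open>a = 0\<close> a nilpotent algebra.\<close>

section \<open>Forms of low degree\<close>

text \<open>The 24 permutations fall into three pairings of the arguments. Each pairing arises 8
  times with the same signed value by skewness, and division by \<open>fact 2 * fact 2\<close>
  leaves the factor 2. The sum is expanded by adjoining one index at a time.\<close>

lemma wedge_2_2:
  assumes skew: "\<And>x y. \<omega> [x, y] = - \<omega> [y, x]"
  shows "wedge 2 2 \<omega> \<omega> [x, y, z, w] =
    2 * (\<omega> [x, y] * \<omega> [z, w] - \<omega> [x, z] * \<omega> [y, w] + \<omega> [x, w] * \<omega> [y, z])"
proof -
  have S: "{..<2 + 2::nat} = {0, 1, 2, 3}"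
    by auto
  have f: "finite {1::nat, 2, 3}" "0 \<notin> {1::nat, 2, 3}" "finite {2::nat, 3}" "1 \<notin> {2::nat, 3}"
    "finite {3::nat}" "2 \<notin> {3::nat}"
    by auto
  have e: "[0..<2] = [0, 1::nat]" "[2..<2+2] = [2, 3::nat]"
    by (simp_all add: upt_rec)
  have n: "[x, y, z, w] ! 2 = z" "[x, y, z, w] ! 3 = w" for x y z w :: 'a
    by (simp_all add: numeral_2_eq_2 numeral_3_eq_3)
  show ?thesis
    unfolding wedge_def e S sum_over_permutations_insert[OF f(1,2)]
      sum_over_permutations_insert[OF f(3,4)] sum_over_permutations_insert[OF f(5,6)] permutes_sing
    using skew[of x y] skew[of x z] skew[of x w] skew[of y z] skew[of y w] skew[of z w]
    by (simp add: sign_compose permutation_compose permutation_swap_id sign_swap_id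
        Transposition.transpose_def n)
qed

lemma ce_d_5:
  "ce_d br \<alpha> [x0, x1, x2, x3, x4] =
    - \<alpha> [br x0 x1, x2, x3, x4] + \<alpha> [br x0 x2, x1, x3, x4] - \<alpha> [br x0 x3, x1, x2, x4]
    + \<alpha> [br x0 x4, x1, x2, x3] - \<alpha> [br x1 x2, x0, x3, x4] + \<alpha> [br x1 x3, x0, x2, x4]
    - \<alpha> [br x1 x4, x0, x2, x3] - \<alpha> [br x2 x3, x0, x1, x4] + \<alpha> [br x2 x4, x0, x1, x3]
    - \<alpha> [br x3 x4, x0, x1, x2]"
  by (simp add: ce_d_def lessThan_Suc nths_Cons eval_nat_numeral)

lemma ce_d_3:
  "ce_d br \<alpha> [x, y, z] = - \<alpha> [br x y, z] + \<alpha> [br x z, y] - \<alpha> [br y z, x]"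
  by (simp add: ce_d_def lessThan_Suc nths_Cons eval_nat_numeral)

lemma list5:
  assumes "length xs = 5" obtains a b c d e where "xs = [a, b, c, d, e]"
  using assms by (auto simp: length_Suc_conv eval_nat_numeral)

lemma list3:
  assumes "length xs = 3" obtains a b c where "xs = [a, b, c]"
  using assms by (auto simp: length_Suc_conv eval_nat_numeral)

lemma fundamental_form_skew:
  assumes "hermitian_structure br J g"
  shows "fundamental_form J g [x, y] = - fundamental_form J g [y, x]"
proof -
  have b: "bilinear g" and s: "\<And>x y. g x y = g y x" and h: "\<And>x y. g (J x) (J y) = g x y"
    and J: "\<And>x. J (J x) = - x"
    using assms by (auto simp: hermitian_structure_def inner_product_def complex_structure_def)
  have "g (J x) y = g (J (J x)) (J y)" using h by simp
  also have "\<dots> = - g (J y) x" unfolding J bilinear_lneg[OF b] by (metis s)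
  finally show ?thesis by (simp add: fundamental_form_def)
qed

section \<open>Invariance under isomorphism\<close>

lemma linear_inv:
  assumes "linear \<phi>" "bij \<phi>" shows "linear (inv \<phi>)"
proof -
  have i: "\<phi> (inv \<phi> x) = x" "inv \<phi> (\<phi> y) = y" for x y
    using assms(2) by (simp_all add: bij_is_inj bij_is_surj surj_f_inv_f)
  show ?thesis
  proof (rule linearI)
    show "inv \<phi> (x + y) = inv \<phi> x + inv \<phi> y" for x y
      by (metis i linear_add[OF assms(1)])
    show "inv \<phi> (c *\<^sub>R x) = c *\<^sub>R inv \<phi> x" for c x
      by (metis i linear_scale[OF assms(1)])
  qed
qed

lemma lie_isomorphic_sym:
  assumes "lie_isomorphic br br'" shows "lie_isomorphic br' br"
proof -
  obtain \<phi> where \<phi>: "linear \<phi>" "bij \<phi>" "\<And>x y. \<phi> (br x y) = br' (\<phi> x) (\<phi> y)"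
    using assms by (auto simp: lie_isomorphic_def)
  have "linear (inv \<phi>)"
    using \<phi>(1,2) by (rule linear_inv)
  moreover have "inv \<phi> (br' x y) = br (inv \<phi> x) (inv \<phi> y)" for x y
    using \<phi>(2,3) by (metis bij_inv_eq_iff)
  ultimately show ?thesis
    using \<phi>(2) bij_imp_bij_inv by (auto simp: lie_isomorphic_def)
qed

lemma lie_isomorphic_trans:
  assumes "lie_isomorphic br br'" "lie_isomorphic br' br''" shows "lie_isomorphic br br''"
proof -
  obtain \<phi> \<psi> where "linear \<phi>" "bij \<phi>" "\<And>x y. \<phi> (br x y) = br' (\<phi> x) (\<phi> y)"
    "linear \<psi>" "bij \<psi>" "\<And>x y. \<psi> (br' x y) = br'' (\<psi> x) (\<psi> y)"
    using assms by (auto simp: lie_isomorphic_def)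
  then show ?thesis
    unfolding lie_isomorphic_def
    by (intro exI[of _ "\<psi> \<circ> \<phi>"]) (auto intro: linear_compose bij_comp)
qed

lemma hermitian_pullback:
  assumes "linear \<phi>" "bij \<phi>" "\<And>x y. \<phi> (br x y) = br' (\<phi> x) (\<phi> y)"
    and "hermitian_structure br' J g"
  shows "hermitian_structure br (\<lambda>x. inv \<phi> (J (\<phi> x))) (\<lambda>x y. g (\<phi> x) (\<phi> y))"
proof -
  have J: "linear J" "\<And>x. J (J x) = - x"
      "\<And>x y. br' (J x) (J y) - J (br' (J x) y) - J (br' x (J y)) - br' x y = 0"
    and g: "bilinear g" "\<And>x y. g x y = g y x" "\<And>x. x \<noteq> 0 \<Longrightarrow> g x x > 0"
      "\<And>x y. g (J x) (J y) = g x y"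
    using assms(4) by (auto simp: hermitian_structure_def complex_structure_def inner_product_def)
  have i: "\<phi> (inv \<phi> x) = x" "inv \<phi> (\<phi> y) = y" for x y
    using assms(2) by (simp_all add: bij_is_inj bij_is_surj surj_f_inv_f)
  have inj: "\<phi> x = \<phi> y \<longleftrightarrow> x = y" for x y
    using assms(2) by (simp add: bij_is_inj inj_eq)
  note lin = linear_add[OF assms(1)] linear_diff[OF assms(1)] linear_neg[OF assms(1)]
    linear_0[OF assms(1)] linear_scale[OF assms(1)]
  have "linear (inv \<phi>)"
    using assms(1,2) by (rule linear_inv)
  then have "linear (\<lambda>x. inv \<phi> (J (\<phi> x)))"
    using linear_compose[OF linear_compose[OF assms(1) J(1)]] by (simp add: o_def)
  moreover have "inv \<phi> (J (\<phi> (inv \<phi> (J (\<phi> x))))) = - x" for x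
    by (simp add: i J inj[symmetric] lin)
  moreover have "bilinear (\<lambda>x y. g (\<phi> x) (\<phi> y))"
    unfolding bilinear_def
    by (auto intro!: linearI simp: lin bilinear_ladd[OF g(1)] bilinear_radd[OF g(1)]
        bilinear_lmul[OF g(1)] bilinear_rmul[OF g(1)])
  moreover have "g (\<phi> x) (\<phi> x) > 0" if "x \<noteq> 0" for x
    using that g(3)[of "\<phi> x"] inj[of x 0] lin by auto
  moreover have "br (inv \<phi> (J (\<phi> x))) (inv \<phi> (J (\<phi> y))) - inv \<phi> (J (\<phi> (br (inv \<phi> (J (\<phi> x))) y)))
      - inv \<phi> (J (\<phi> (br x (inv \<phi> (J (\<phi> y)))))) - br x y = 0" for x y
    using J(3)[of "\<phi> x" "\<phi> y"] by (subst inj[symmetric]) (simp add: i lin assms(3))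
  ultimately show ?thesis
    using g(2,4) i unfolding hermitian_structure_def complex_structure_def inner_product_def
    by simp
qed

lemma fundamental_form_pullback:
  assumes "bij \<phi>"
  shows "fundamental_form (\<lambda>x. inv \<phi> (J (\<phi> x))) (\<lambda>x y. g (\<phi> x) (\<phi> y)) [x, y] =
    fundamental_form J g [\<phi> x, \<phi> y]"
  using assms by (simp add: fundamental_form_def bij_is_surj surj_f_inv_f)

lemma balanced_lie_isomorphic:
  assumes "lie_isomorphic br br'" "balanced_structure br' J g"
  shows "\<exists>J g. balanced_structure br J g"
proof -
  obtain \<phi> where \<phi>: "linear \<phi>" "bij \<phi>" "\<And>x y. \<phi> (br x y) = br' (\<phi> x) (\<phi> y)"
    using assms by (auto simp: lie_isomorphic_def)
  let ?J = "\<lambda>x. inv \<phi> (J (\<phi> x))" and ?g = "\<lambda>x y. g (\<phi> x) (\<phi> y)"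
  have h': "hermitian_structure br' J g"
    and c: "\<And>xs. length xs = 5 \<Longrightarrow>
        ce_d br' (wedge 2 2 (fundamental_form J g) (fundamental_form J g)) xs = 0"
    using assms(2) by (auto simp: balanced_structure_def)
  have h: "hermitian_structure br ?J ?g"
    by (rule hermitian_pullback[OF \<phi> h'])
  have "ce_d br (wedge 2 2 (fundamental_form ?J ?g) (fundamental_form ?J ?g)) xs = 0"
    if len: "length xs = 5" for xs
  proof -
    obtain x0 x1 x2 x3 x4 where xs: "xs = [x0, x1, x2, x3, x4]"
      using len by (rule list5)
    \<comment> \<open>By \<open>wedge_2_2\<close> both sides are the same polynomial in the values
      of the two fundamental forms, which agree under \<open>\<phi>\<close>. Since
      \<open>\<phi>\<close> also respects brackets, the differential is pulled back term by
      term.\<close>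
    have w: "wedge 2 2 (fundamental_form ?J ?g) (fundamental_form ?J ?g) [x, y, z, w] =
        wedge 2 2 (fundamental_form J g) (fundamental_form J g) [\<phi> x, \<phi> y, \<phi> z, \<phi> w]" for x y z w
      by (simp only: fundamental_form_pullback[OF \<phi>(2)]
          wedge_2_2[of "fundamental_form J g", OF fundamental_form_skew[OF h']]
          wedge_2_2[of "fundamental_form ?J ?g", OF fundamental_form_skew[OF h]])
    show ?thesis
      using c[of "map \<phi> xs"] by (simp add: xs ce_d_5 w \<phi>(3))
  qed
  then show ?thesis
    using h unfolding balanced_structure_def by blast
qed

lemma kahler_lie_isomorphic:
  assumes "lie_isomorphic br br'" "kahler_structure br' J g"
  shows "\<exists>J g. kahler_structure br J g"
proof -
  obtain \<phi> where \<phi>: "linear \<phi>" "bij \<phi>" "\<And>x y. \<phi> (br x y) = br' (\<phi> x) (\<phi> y)"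
    using assms by (auto simp: lie_isomorphic_def)
  let ?J = "\<lambda>x. inv \<phi> (J (\<phi> x))" and ?g = "\<lambda>x y. g (\<phi> x) (\<phi> y)"
  have h': "hermitian_structure br' J g"
    and c: "\<And>xs. length xs = 3 \<Longrightarrow> ce_d br' (fundamental_form J g) xs = 0"
    using assms(2) by (auto simp: kahler_structure_def)
  have h: "hermitian_structure br ?J ?g"
    by (rule hermitian_pullback[OF \<phi> h'])
  have "ce_d br (fundamental_form ?J ?g) xs = 0" if len: "length xs = 3" for xs
  proof -
    obtain x y z where xs: "xs = [x, y, z]"
      using len by (rule list3)
    show ?thesis
      using c[of "map \<phi> xs"] unfolding xs ce_d_3 fundamental_form_pullback[OF \<phi>(2)]
      by (simp add: ce_d_3 \<phi>(3))
  qed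
  then show ?thesis
    using h unfolding kahler_structure_def by blast
qed

lemma nilpotent_lie_isomorphic:
  assumes "lie_isomorphic br br'" "nilpotent_lie br"
  shows "nilpotent_lie br'"
proof -
  obtain \<phi> where \<phi>: "linear \<phi>" "bij \<phi>" "\<And>x y. \<phi> (br x y) = br' (\<phi> x) (\<phi> y)"
    using assms by (auto simp: lie_isomorphic_def)
  have "lower_central_series br' k = \<phi> ` lower_central_series br k" for k
  proof (induction k)
    case 0
    then show ?case using \<phi>(2) by (simp add: bij_is_surj)
  next
    case (Suc k)
    have "{br' x y |x y. y \<in> lower_central_series br' k} =
        \<phi> ` {br x y |x y. y \<in> lower_central_series br k}"
      unfolding Suc.IH using \<phi>(2,3) by (auto simp: image_iff) (metis bij_pointE)+
    then show ?case
      by (simp add: linear_span_image[OF \<phi>(1)])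
  qed
  then show ?thesis
    using assms(2) linear_0[OF \<phi>(1)] by (force simp: nilpotent_lie_def)
qed

section \<open>The model algebras\<close>

type_synonym cx_space = "real \<times> (complex \<times> complex) \<times> real"

definition cx_mat :: "complex \<Rightarrow> complex \<Rightarrow> complex \<Rightarrow> complex \<Rightarrow> complex \<times> complex \<Rightarrow> complex \<times> complex" where
  "cx_mat m11 m12 m21 m22 X = (m11 * fst X + m12 * snd X, m21 * fst X + m22 * snd X)"

text \<open>The semidirect product in which the last coordinate acts on the abelian ideal
  \<open>\<real> \<oplus> \<complex>\<^sup>2\<close> by \<open>diag(a, M)\<close>, with \<open>M\<close> a complex matrix.\<close>

fun cx_alg :: "real \<Rightarrow> complex \<Rightarrow> complex \<Rightarrow> complex \<Rightarrow> complex \<Rightarrow> cx_space \<Rightarrow> cx_space \<Rightarrow> cx_space" where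
  "cx_alg a m11 m12 m21 m22 (x, X, t) (y, Y, u) =
    (a * (t * y - u * x), cx_mat m11 m12 m21 m22 (t *\<^sub>R Y - u *\<^sub>R X), 0)"

text \<open>Multiplication by i on the complex plane, together with a rotation pairing the acting
  direction with the real line of the ideal. All models share this complex structure and the
  standard inner product, whatever \<open>a\<close> and the matrix are.\<close>

fun cx_J :: "cx_space \<Rightarrow> cx_space" where
  "cx_J (x, X, t) = (- t, (\<i> * fst X, \<i> * snd X), x)"

text \<open>Integrability holds because the matrix is complex linear and the plane of the two real
  coordinates is a \<open>cx_J\<close>-invariant subalgebra.\<close>

lemma hermitian_cx_alg: "hermitian_structure (cx_alg a m11 m12 m21 m22) cx_J inner"
  unfolding hermitian_structure_def complex_structure_def inner_product_def
proof (intro conjI allI impI)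
  show "linear cx_J"
    by (rule linearI) (auto simp: scaleR_conv_of_real algebra_simps)
  show "bilinear ((\<bullet>) :: cx_space \<Rightarrow> _)"
    by (simp add: bilinear_conv_bounded_bilinear bounded_bilinear_inner)
  show "cx_J (cx_J x) = - x" for x
    by (cases x) (auto simp: mult.assoc[symmetric])
  show "cx_alg a m11 m12 m21 m22 (cx_J x) (cx_J y) - cx_J (cx_alg a m11 m12 m21 m22 (cx_J x) y) -
      cx_J (cx_alg a m11 m12 m21 m22 x (cx_J y)) - cx_alg a m11 m12 m21 m22 x y = 0" for x y
    by (cases x; cases y) (auto simp: zero_prod_def cx_mat_def scaleR_conv_of_real algebra_simps)
  show "cx_J x \<bullet> cx_J y = x \<bullet> y" for x y
    by (cases x; cases y) (auto simp: inner_complex_def)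
qed (auto simp: inner_commute)

text \<open>The standard symplectic form of the complex plane, that is, the restriction of the
  fundamental form to it.\<close>

definition cx_omega :: "complex \<times> complex \<Rightarrow> complex \<times> complex \<Rightarrow> real" where
  "cx_omega X Y = (\<i> * fst X) \<bullet> fst Y + (\<i> * snd X) \<bullet> snd Y"

text \<open>The action of a matrix on \<open>\<omega> \<and> \<omega>\<close>, a top-degree form on \<open>\<complex>\<^sup>2\<close>, is multiplication by its
  real trace.\<close>

lemma cx_omega_trace:
  fixes X1 X2 X3 X4 :: "complex \<times> complex" and m11 m12 m21 m22 :: complex
  assumes "Re m11 + Re m22 = 0"
  defines "S \<equiv> \<lambda>X Y. cx_omega (cx_mat m11 m12 m21 m22 X) Y"
  shows "(S X1 X2 - S X2 X1) * cx_omega X3 X4 - (S X1 X3 - S X3 X1) * cx_omega X2 X4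
    + (S X1 X4 - S X4 X1) * cx_omega X2 X3 + (S X2 X3 - S X3 X2) * cx_omega X1 X4
    - (S X2 X4 - S X4 X2) * cx_omega X1 X3 + (S X3 X4 - S X4 X3) * cx_omega X1 X2 = 0"
proof -
  \<comment> \<open>\<open>e f g\<close> is the wedge product of two real coordinate
    functions.\<close>
  define e where "e = (\<lambda>f g (X :: complex \<times> complex) (Y :: complex \<times> complex).
    f X * g Y - f Y * g X :: real)"
  let ?x1 = "\<lambda>X. Re (fst X)" and ?x2 = "\<lambda>X. Im (fst X)" and ?x3 = "\<lambda>X. Re (snd X)"
    and ?x4 = "\<lambda>X. Im (snd X)"
  have \<omega>: "cx_omega X Y = e ?x1 ?x2 X Y + e ?x3 ?x4 X Y" for X Y
    by (simp add: cx_omega_def inner_complex_def e_def)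
  have m: "Re m22 = - Re m11"
    using assms(1) by simp
  \<comment> \<open>Once the real trace is zero, the action on the symplectic form is a combination
    of three 2-forms, each of which has zero wedge product with that form. The goal is this wedge
    product evaluated on four vectors.\<close>
  have D: "S X Y - S Y X = 2 * Re m11 * (e ?x1 ?x2 X Y - e ?x3 ?x4 X Y)
      + (Im m12 - Im m21) * (e ?x1 ?x3 X Y + e ?x2 ?x4 X Y)
      + (Re m12 + Re m21) * (e ?x1 ?x4 X Y - e ?x2 ?x3 X Y)" for X Y
    unfolding S_def
    by (simp add: cx_omega_def cx_mat_def e_def inner_complex_def m algebra_simps)
  show ?thesis
    unfolding D \<omega> unfolding e_def by algebra
qed

lemma fundamental_form_cx:
  "fundamental_form cx_J inner [(x, X, t), (y, Y, u)] =
    x * u - t * y + cx_omega X Y"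
  by (simp add: fundamental_form_def cx_omega_def inner_prod_def)

lemma fundamental_form_cx_alg:
  fixes m11 m12 m21 m22 defines "S \<equiv> \<lambda>X Y. cx_omega (cx_mat m11 m12 m21 m22 X) Y"
  shows "fundamental_form cx_J inner [cx_alg a m11 m12 m21 m22 (x, X, t) (y, Y, u), (z, Z, v)] =
    a * (t * y - u * x) * v + t * S Y Z - u * S X Z"
  unfolding S_def
  by (cases X; cases Y; cases Z)
    (simp add: fundamental_form_def cx_omega_def cx_mat_def inner_complex_def algebra_simps)

lemma balanced_cx_alg:
  assumes "Re m11 + Re m22 = 0"
  shows "balanced_structure (cx_alg a m11 m12 m21 m22) cx_J inner"
  unfolding balanced_structure_def
proof (intro conjI allI impI)
  show "hermitian_structure (cx_alg a m11 m12 m21 m22) cx_J (\<bullet>)"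
    by (rule hermitian_cx_alg)
  note skew = fundamental_form_skew[OF this]
  fix xs :: "cx_space list"
  assume "length xs = 5"
  then obtain A B C D E where xs: "xs = [A, B, C, D, E]" by (rule list5)
  then obtain ta A' ua tb B' ub tc C' uc td D' ud te E' ue where c: "A = (ta, A', ua)"
    "B = (tb, B', ub)" "C = (tc, C', uc)" "D = (td, D', ud)" "E = (te, E', ue)"
    by (metis prod.exhaust_sel)
  define S where "S = (\<lambda>X Y. cx_omega (cx_mat m11 m12 m21 m22 X) Y)"
  note tr = cx_omega_trace[OF assms, where ?m12.0 = m12 and ?m21.0 = m21, folded S_def]
  show "ce_d (cx_alg a m11 m12 m21 m22)
      (wedge 2 2 (fundamental_form cx_J inner) (fundamental_form cx_J inner)) xs = 0"
    unfolding xs ce_d_5 wedge_2_2[of "fundamental_form cx_J inner", OF skew]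
    \<comment> \<open>The last coordinate of each argument is multiplied by the trace expression in
      the complex parts of the other four. Hence one instance of \<open>tr\<close> for each omitted
      argument; the terms with \<open>a\<close> cancel.\<close>
    unfolding c fundamental_form_cx_alg fundamental_form_cx S_def[symmetric]
    using tr[where ?X1.0=B' and ?X2.0=C' and ?X3.0=D' and ?X4.0=E'] tr[where ?X1.0=A' and ?X2.0=C' and ?X3.0=D' and ?X4.0=E'] tr[where ?X1.0=A' and ?X2.0=B' and ?X3.0=D' and ?X4.0=E'] tr[where ?X1.0=A' and ?X2.0=B' and ?X3.0=C' and ?X4.0=E'] tr[where ?X1.0=A' and ?X2.0=B' and ?X3.0=C' and ?X4.0=D']
    by algebra
qed

text \<open>The matrix is skew-Hermitian, so it preserves \<open>cx_omega\<close>. The entry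
  \<open>a\<close> only acts in the plane of the two real coordinates, where every 3-form
  vanishes.\<close>

lemma kahler_cx_alg:
  "kahler_structure (cx_alg a (Complex 0 s1) 0 0 (Complex 0 s2)) cx_J inner"
  unfolding kahler_structure_def
proof (intro conjI allI impI)
  fix xs :: "cx_space list"
  assume "length xs = 3"
  then obtain A B C where xs: "xs = [A, B, C]" by (rule list3)
  have S: "cx_omega (cx_mat (Complex 0 s1) 0 0 (Complex 0 s2) X) Y =
      cx_omega (cx_mat (Complex 0 s1) 0 0 (Complex 0 s2) Y) X" for X Y
    by (simp add: cx_omega_def cx_mat_def inner_complex_def algebra_simps)
  show "ce_d (cx_alg a (Complex 0 s1) 0 0 (Complex 0 s2)) (fundamental_form cx_J inner) xs = 0"
    unfolding xs ce_d_3
    by (cases A; cases B; cases C) (simp only: fundamental_form_cx_alg, subst S,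
        simp add: fundamental_form_cx_alg cx_omega_def cx_mat_def inner_complex_def algebra_simps)
qed (rule hermitian_cx_alg)

text \<open>The matrix squares to zero: all brackets lie in its image \<open>?V\<close>, which is
  central, so the algebra is two-step nilpotent.\<close>

lemma nilpotent_cx_alg: "nilpotent_lie (cx_alg 0 0 1 0 0)"
proof -
  let ?br = "cx_alg 0 0 1 0 0"
  let ?V = "{(0, (z, 0), 0) | z. True} :: cx_space set"
  have "subspace ?V"
    by (auto simp: subspace_def zero_prod_def)
  moreover have "?br x y \<in> ?V" for x y
    by (cases x; cases y) (auto simp: cx_mat_def)
  ultimately have 1: "lower_central_series ?br 1 \<subseteq> ?V"
    unfolding One_nat_def lower_central_series.simps by (intro span_minimal) blast+
  have "?br x y = 0" if "y \<in> ?V" for x y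
    using that by (cases x) (auto simp: cx_mat_def zero_prod_def)
  then have "{?br x y | x y. y \<in> lower_central_series ?br 1} \<subseteq> {0}"
    using 1 by blast
  then have "lower_central_series ?br (Suc 1) \<subseteq> {0}"
    unfolding lower_central_series.simps(2)[of _ 1] by (intro span_minimal) auto
  moreover have "0 \<in> lower_central_series ?br (Suc 1)"
    by (simp add: span_zero)
  ultimately show ?thesis
    unfolding nilpotent_lie_def by blast
qed

section \<open>Balanced almost abelian algebras\<close>

text \<open>A basis of the hyperplane is extended by one vector \<open>e\<close>, and the indices
  are matched so that \<open>e\<close> receives index 6. This moves the problem from an abstract
  vector space to a Euclidean one.\<close>

lemma hyperplane_coordinates:
  fixes I :: "'a::real_vector set"
  assumes "subspace I" "dim I = 5" "dim (UNIV :: 'a set) = 6"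
  obtains \<phi> :: "real^6 \<Rightarrow> 'a" where "linear \<phi>" "bij \<phi>" "\<And>x. \<phi> x \<in> I \<longleftrightarrow> x $ 6 = 0"
proof -
  obtain B where B: "B \<subseteq> I" "independent B" "I \<subseteq> span B" "card B = 5"
    using basis_exists[of I] assms(2) by metis
  obtain B' where B': "B \<subseteq> B'" "independent B'" "UNIV \<subseteq> span B'"
    using maximal_independent_subset_extend[of B UNIV] B(2) by auto
  have card: "card B' = 6"
    using B' assms(3) by (metis basis_card_eq_dim subset_UNIV)
  \<comment> \<open>Infinite sets have cardinality 0, so the positive cardinalities give
    finiteness.\<close>
  have fin: "finite B" "finite B'"
    using B(4) card by (auto intro: card_ge_0_finite)
  have "card (B' - B) = 1"
    using B'(1) B(4) card fin by (simp add: card_Diff_subset)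
  then obtain e where e: "B' - B = {e}"
    by (auto simp: card_1_singleton_iff)
  then have B'_eq: "B' = insert e B" "e \<notin> B"
    using B'(1) by auto
  have spanB: "span B = I"
    using B(1,3) assms(1) span_minimal by blast
  have eI: "e \<notin> I"
    using B'(2) B'_eq spanB by (metis Diff_insert_absorb dependent_def insertI1)
  have "card (UNIV - {6 :: 6}) = card B"
    by (simp add: B(4) card_Diff_subset)
  then obtain h where h: "bij_betw h (UNIV - {6 :: 6}) B"
    using finite_same_card_bij[OF _ fin(1)] by (metis finite)
  define b where "b = (\<lambda>i :: 6. if i = 6 then e else h i)"
  have "bij_betw b (UNIV - {6}) B"
    using h by (rule bij_betw_cong[THEN iffD1, rotated]) (auto simp: b_def)
  then have hB: "b i \<in> B" if "i \<noteq> 6" for i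
    using that by (auto simp: bij_betw_def)
  have b: "bij_betw b UNIV B'"
    using bij_betw_combine[OF \<open>bij_betw b (UNIV - {6}) B\<close>, of "{6}" "{e}"] B'_eq
    by (simp add: b_def bij_betw_def insert_absorb)
  define \<phi> where "\<phi> = (\<lambda>x :: real^6. \<Sum>i\<in>UNIV. x $ i *\<^sub>R b i)"
  have lin: "linear \<phi>"
    unfolding \<phi>_def by (rule linearI) (simp_all add: scaleR_add_left sum.distrib scaleR_sum_right)
  have "x = 0" if "\<phi> x = 0" for x
  proof -
    have "\<phi> x = (\<Sum>v\<in>B'. x $ (inv_into UNIV b v) *\<^sub>R v)"
      unfolding \<phi>_def
      by (subst sum.reindex_bij_betw[OF b, symmetric]) (simp add: bij_betw_imp_inj_on[OF b])
    then have "x $ (inv_into UNIV b v) = 0" if "v \<in> B'" for v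
      using independentD[OF B'(2) fin(2) subset_refl, of "\<lambda>v. x $ inv_into UNIV b v"] that
        \<open>\<phi> x = 0\<close> by simp
    then have "x $ i = 0" for i
      using b by (metis UNIV_I bij_betw_apply bij_betw_imp_inj_on inv_into_f_f)
    then show "x = 0"
      by (simp add: vec_eq_iff)
  qed
  then have "inj \<phi>"
    by (simp add: linear_injective_0[OF lin])
  have "b i \<in> range \<phi>" for i
  proof -
    have "\<phi> (axis i 1) = b i"
      by (simp add: \<phi>_def axis_def if_distrib[of "\<lambda>c. c *\<^sub>R _"] cong: if_cong)
    then show ?thesis by (metis rangeI)
  qed
  then have "B' \<subseteq> range \<phi>"
    using b by (auto simp: bij_betw_def)
  then have "span B' \<subseteq> range \<phi>"
    by (rule span_minimal) (simp add: linear_subspace_image[OF lin])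
  then have "surj \<phi>"
    using B'(3) by auto
  have "\<phi> x \<in> I \<longleftrightarrow> x $ 6 = 0" for x
  proof -
    have 1: "\<phi> x = x $ 6 *\<^sub>R e + (\<Sum>i\<in>UNIV - {6}. x $ i *\<^sub>R b i)"
      unfolding \<phi>_def by (subst sum.remove[of _ 6]) (auto simp: b_def)
    have 2: "(\<Sum>i\<in>UNIV - {6}. x $ i *\<^sub>R b i) \<in> I"
      using hB B(1) by (intro subspace_sum subspace_scale assms(1)) auto
    have "u + v \<in> I \<longleftrightarrow> u \<in> I" if "v \<in> I" for u v
      using subspace_add[OF assms(1) _ that] subspace_diff[OF assms(1) _ that, of "u + v"] by auto
    from this[OF 2] have "\<phi> x \<in> I \<longleftrightarrow> x $ 6 *\<^sub>R e \<in> I"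
      unfolding 1 .
    also have "\<dots> \<longleftrightarrow> x $ 6 = 0"
    proof
      assume "x $ 6 *\<^sub>R e \<in> I"
      from subspace_scale[OF assms(1) this, of "inverse (x $ 6)"] show "x $ 6 = 0"
        using eI by (cases "x $ 6 = 0") auto
    qed (simp add: subspace_0[OF assms(1)])
    finally show ?thesis .
  qed
  then show ?thesis
    using that lin \<open>inj \<phi>\<close> \<open>surj \<phi>\<close> by (simp add: bij_def)
qed

text \<open>As the ideal is abelian of codimension one, the bracket is determined by
  \<open>D\<close>, the adjoint action of a vector \<open>e\<close> with sixth coordinate 1. Its
  values lie in the ideal, since \<open>br e e = 0\<close>.\<close>

lemma almost_abelian_coordinates:
  fixes br :: "'a::real_vector \<Rightarrow> 'a \<Rightarrow> 'a"
  assumes "lie_algebra br" "almost_abelian br" "dim (UNIV :: 'a set) = 6"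
  obtains D where "linear D" "\<And>x. D x $ 6 = 0"
    "lie_isomorphic (\<lambda>x y :: real^6. x $ 6 *\<^sub>R D y - y $ 6 *\<^sub>R D x) br"
proof -
  obtain I where I: "lie_ideal br I" "\<And>x y. x \<in> I \<Longrightarrow> y \<in> I \<Longrightarrow> br x y = 0" "dim I = 5"
    using assms(2,3) by (auto simp: almost_abelian_def)
  have bil: "bilinear br" and br0: "\<And>x. br x x = 0"
    using assms(1) by (auto simp: lie_algebra_def)
  have sub: "subspace I" and ideal: "\<And>x y. y \<in> I \<Longrightarrow> br x y \<in> I"
    using I(1) by (auto simp: lie_ideal_def)
  have skew: "br x y = - br y x" for x y
    using br0[of "x + y"] unfolding bilinear_ladd[OF bil] bilinear_radd[OF bil]
    by (simp add: br0 eq_neg_iff_add_eq_0 add.commute)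
  obtain \<phi> :: "real^6 \<Rightarrow> 'a" where \<phi>: "linear \<phi>" "bij \<phi>" "\<And>x. \<phi> x \<in> I \<longleftrightarrow> x $ 6 = 0"
    using hyperplane_coordinates[OF sub I(3) assms(3)] by blast
  note lin = linear_add[OF \<phi>(1)] linear_diff[OF \<phi>(1)] linear_scale[OF \<phi>(1)]
  define e where "e = \<phi> (axis 6 1)"
  define D where "D = (\<lambda>x. inv \<phi> (br e (\<phi> x)))"
  have i: "\<phi> (inv \<phi> x) = x" "inv \<phi> (\<phi> y) = y" for x y
    using \<phi>(2) by (simp_all add: bij_is_inj bij_is_surj surj_f_inv_f)
  have inj: "\<phi> x = \<phi> y \<longleftrightarrow> x = y" for x y
    using \<phi>(2) by (simp add: bij_is_inj inj_eq)
  have "linear D"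
    by (rule linearI; subst inj[symmetric])
      (simp_all add: D_def i lin bilinear_radd[OF bil] bilinear_rmul[OF bil])
  have split: "\<exists>x'\<in>I. \<phi> x = x $ 6 *\<^sub>R e + x'" for x
  proof
    show "\<phi> x = x $ 6 *\<^sub>R e + \<phi> (x - x $ 6 *\<^sub>R axis 6 1)"
      by (simp add: e_def lin)
    show "\<phi> (x - x $ 6 *\<^sub>R axis 6 1) \<in> I"
      by (simp add: \<phi>(3))
  qed
  have "D x $ 6 = 0" for x
  proof -
    obtain x' where "x' \<in> I" "\<phi> x = x $ 6 *\<^sub>R e + x'"
      using split by blast
    then have "br e (\<phi> x) \<in> I"
      using ideal by (simp add: bilinear_radd[OF bil] bilinear_rmul[OF bil] br0)
    then show ?thesis
      by (simp add: D_def \<phi>(3)[symmetric] i)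
  qed
  moreover have "\<phi> (x $ 6 *\<^sub>R D y - y $ 6 *\<^sub>R D x) = br (\<phi> x) (\<phi> y)" for x y
  proof -
    obtain x' y' where xy: "x' \<in> I" "\<phi> x = x $ 6 *\<^sub>R e + x'" "y' \<in> I" "\<phi> y = y $ 6 *\<^sub>R e + y'"
      using split by meson
    show ?thesis
      unfolding lin D_def i xy(2,4) using I(2)[OF xy(1,3)] skew[of x' e]
      by (simp add: bilinear_radd[OF bil] bilinear_rmul[OF bil] bilinear_ladd[OF bil] bilinear_lmul[OF bil] br0)
  qed
  ultimately show ?thesis
    using that \<open>linear D\<close> \<phi>(1,2) by (force simp: lie_isomorphic_def)
qed

text \<open>The inner product \<open>g\<close> need not be that of the type. The map
  \<open>M\<close>, given by the Gram matrix of \<open>g\<close>, is injective by positivity, hence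
  surjective in finite dimension.\<close>

lemma inner_product_riesz:
  fixes g :: "'a::euclidean_space \<Rightarrow> 'a \<Rightarrow> real"
  assumes "inner_product g" "linear t"
  obtains e where "\<And>x. g e x = t x"
proof -
  have bil: "bilinear g" and pos: "\<And>x. x \<noteq> 0 \<Longrightarrow> g x x > 0"
    using assms(1) by (auto simp: inner_product_def)
  define M where "M = (\<lambda>e. \<Sum>b\<in>Basis. g e b *\<^sub>R b)"
  have ext: "g e x = f x" if "linear f" "\<And>b. b \<in> Basis \<Longrightarrow> g e b = f b" for e x f
    using linear_eq_stdbasis[of "g e" f] that bil by (auto simp: bilinear_def)
  have linM: "linear M"
    unfolding M_def
    by (rule linearI)
      (simp_all add: bilinear_ladd[OF bil] bilinear_lmul[OF bil] scaleR_add_left sum.distrib scaleR_sum_right)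
  have "e = 0" if "M e = 0" for e
  proof (rule ccontr)
    assume "e \<noteq> 0"
    have "g e b = 0" if "b \<in> Basis" for b
      using arg_cong[OF \<open>M e = 0\<close>, of "\<lambda>y. y \<bullet> b"] that by (simp add: M_def)
    then have "g e e = 0"
      using ext[of "\<lambda>x. 0" e e] by (simp add: linear_zero)
    then show False
      using pos[OF \<open>e \<noteq> 0\<close>] by simp
  qed
  then have "surj M"
    using linM by (simp add: linear_injective_0 linear_injective_imp_surjective)
  then obtain e where e: "M e = (\<Sum>b\<in>Basis. t b *\<^sub>R b)"
    by (metis surjD)
  then have "g e b = t b" if "b \<in> Basis" for b
    using that e unfolding M_def by (metis inner_sum_left_Basis)
  then show ?thesis
    using that ext[OF assms(2)] by blast
qed

lemma linear_kernel_nontrivial: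
  fixes f :: "'a::euclidean_space \<Rightarrow> 'b::euclidean_space"
  assumes "linear f" "DIM('b) < DIM('a)"
  obtains x where "x \<noteq> 0" "f x = 0"
proof (rule ccontr)
  assume "\<not> thesis"
  then have "inj f"
    using that assms(1) by (metis linear_injective_0)
  then have "dim (range f) = DIM('a)"
    using assms(1) by (simp add: dim_image_eq)
  then show False
    using assms(2) dim_subset_UNIV[of "range f"] by simp
qed

text \<open>The functional \<open>t\<close> has the abelian ideal as its kernel. The isomorphism
  comes from an orthogonal basis consisting of \<open>J e\<close>, a complex basis \<open>x\<close>,
  \<open>y\<close> of the maximal \<open>J\<close>-invariant part of the kernel, and
  \<open>e\<close>.\<close>

lemma balanced_imp_cx_alg:
  fixes D :: "'a::euclidean_space \<Rightarrow> 'a" and t :: "'a \<Rightarrow> real"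
  defines "br \<equiv> \<lambda>x y. t x *\<^sub>R D y - t y *\<^sub>R D x"
  assumes D: "linear D" "\<And>x. t (D x) = 0" and t: "linear t" "t u \<noteq> 0"
    and dim: "DIM('a) = 6" and bal: "balanced_structure br J g"
  obtains a m11 m12 m21 m22 where "Re m11 + Re m22 = 0"
    "lie_isomorphic (cx_alg a m11 m12 m21 m22) br"
proof -
  have herm: "hermitian_structure br J g"
    and dw: "\<And>xs. length xs = 5 \<Longrightarrow>
        ce_d br (wedge 2 2 (fundamental_form J g) (fundamental_form J g)) xs = 0"
    using bal by (auto simp: balanced_structure_def)
  have inner: "inner_product g" and J: "linear J" "\<And>x. J (J x) = - x"
    and N: "\<And>x y. br (J x) (J y) - J (br (J x) y) - J (br x (J y)) - br x y = 0"
    and gJJ: "\<And>x y. g (J x) (J y) = g x y"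
    using herm by (auto simp: hermitian_structure_def complex_structure_def)
  have bil: "bilinear g" and sym: "\<And>x y. g x y = g y x" and pos: "\<And>x. x \<noteq> 0 \<Longrightarrow> g x x > 0"
    using inner by (auto simp: inner_product_def)
  note g_simps = bilinear_ladd[OF bil] bilinear_radd[OF bil] bilinear_lmul[OF bil]
    bilinear_rmul[OF bil] bilinear_lneg[OF bil] bilinear_rneg[OF bil] bilinear_lzero[OF bil]
    bilinear_rzero[OF bil] bilinear_lsub[OF bil] bilinear_rsub[OF bil]
  note lin = linear_add[OF D(1)] linear_diff[OF D(1)] linear_scale[OF D(1)] linear_0[OF D(1)]
    linear_add[OF J(1)] linear_diff[OF J(1)] linear_scale[OF J(1)] linear_0[OF J(1)] linear_neg[OF J(1)]
    linear_add[OF t(1)] linear_diff[OF t(1)] linear_scale[OF t(1)] linear_0[OF t(1)] linear_neg[OF t(1)]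
  have gJl: "g (J x) y = - g x (J y)" for x y
    using gJJ[of "J x" y] by (simp add: J g_simps)
  have gJ0: "g x (J x) = 0" for x
    using gJl[of x x] sym[of "J x" x] by simp

  obtain e0 where e0: "\<And>x. g e0 x = t x"
    using inner_product_riesz[OF inner t(1)] by blast
  have "e0 \<noteq> 0"
    using e0[of u] t(2) by (auto simp: g_simps)
  define k where "k = t e0"
  have k: "k > 0"
    using pos[OF \<open>e0 \<noteq> 0\<close>] by (simp add: e0 k_def)
  \<comment> \<open>Scaled so that \<open>t e = 1\<close>; \<open>e\<close> is
    \<open>g\<close>-orthogonal to the kernel of \<open>t\<close> because \<open>e0\<close>
    represents \<open>t\<close>.\<close>
  define e where "e = e0 /\<^sub>R k"
  have te: "t e = 1" and ge: "g e x = t x / k" for x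
    using k by (simp_all add: e_def lin g_simps e0 k_def divide_inverse)
  have tJe: "t (J e) = 0"
    using gJ0[of e] k by (simp add: ge)
  have gee: "g e e > 0"
    using k by (simp add: ge te)
  have gJe: "g (J e) x = - t (J x) / k" for x
    by (simp add: gJl ge)

  define n1 where "n1 = {x. t x = 0 \<and> t (J x) = 0}"
  have n1J: "J x \<in> n1" if "x \<in> n1" for x
    using that by (simp add: n1_def J lin)
  have n1D: "D (J x) = J (D x)" "D x \<in> n1" if "x \<in> n1" for x
  proof -
    \<comment> \<open>In the integrability identity for \<open>e\<close> and \<open>x\<close>, the
      brackets of \<open>J e\<close> with \<open>x\<close> and \<open>J x\<close> vanish, all three
      vectors being in the kernel of \<open>t\<close>.\<close>
    have "- J (D (J x)) - D x = 0"
      using N[of e x] that te tJe by (simp add: br_def n1_def lin)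
    then have "J (J (D (J x))) = J (- D x)"
      by (simp add: eq_neg_iff_add_eq_0)
        (metis add.commute add_eq_0_iff)
    then show DJ: "D (J x) = J (D x)"
      by (simp add: J lin)
    show "D x \<in> n1"
      using D(2)[of x] D(2)[of "J x"] by (simp add: n1_def DJ)
  qed
  have n1_ex: "\<exists>y\<in>n1. y \<noteq> 0 \<and> g x y = 0 \<and> g (J x) y = 0" for x
  proof -
    \<comment> \<open>Four linear conditions on a space of dimension six have a nonzero common
      solution.\<close>
    have "linear (\<lambda>y. (t y, t (J y), g x y, g (J x) y))"
      by (rule linearI) (simp_all add: lin g_simps)
    then obtain y where "y \<noteq> 0" "(t y, t (J y), g x y, g (J x) y) = 0"
      by (rule linear_kernel_nontrivial) (simp add: dim)
    then show ?thesis
      by (auto simp: n1_def zero_prod_def)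
  qed

  define \<omega> where "\<omega> = (\<lambda>x y. g (J x) y)"
  have \<omega>_skew: "\<omega> x y = - \<omega> y x" for x y
    using gJl[of x y] sym[of "J y" x] by (simp add: \<omega>_def)
  have \<omega>0: "\<omega> 0 y = 0" for y
    by (simp add: \<omega>_def lin g_simps)
  define E where "E = (\<lambda>x y z w. \<omega> x y * \<omega> z w - \<omega> x z * \<omega> y w + \<omega> x w * \<omega> y z)"
  \<comment> \<open>\<open>d\<omega>\<^sup>2\<close> evaluated on \<open>e\<close> and four vectors of the ideal, on which only the brackets with \<open>e\<close> survive\<close>
  have balE: "E (D x) y z w - E (D y) x z w + E (D z) x y w - E (D w) x y z = 0"
    if "t x = 0" "t y = 0" "t z = 0" "t w = 0" for x y z w
  proof -
    have W: "wedge 2 2 (fundamental_form J g) (fundamental_form J g) [a, b, c, d] = 2 * E a b c d"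
      for a b c d
      unfolding wedge_2_2[of "fundamental_form J g", OF fundamental_form_skew[OF herm]]
      by (simp add: fundamental_form_def E_def \<omega>_def)
    show ?thesis
      using dw[of "[e, x, y, z, w]"] that
      by (simp add: ce_d_5 W br_def te) (simp add: E_def \<omega>0)
  qed

  \<comment> \<open>Since \<open>t (J (J e)) = - 1\<close>, this value puts the remainder
    \<open>D (J e) - a *\<^sub>R J e\<close> into \<open>n1\<close>.\<close>
  define a where "a = - t (J (D (J e)))"
  have De1: "D (J e) = a *\<^sub>R J e"
  proof (rule ccontr)
    assume "D (J e) \<noteq> a *\<^sub>R J e"
    define v where "v = D (J e) - a *\<^sub>R J e"
    have v: "v \<noteq> 0" "v \<in> n1"
      using \<open>D (J e) \<noteq> a *\<^sub>R J e\<close>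
      by (simp add: v_def, simp add: v_def n1_def lin D(2) tJe J te a_def)
    \<comment> \<open>The balanced condition is tested on \<open>J e\<close>, \<open>J v\<close>,
      \<open>y\<close>, \<open>J y\<close>. As \<open>J e\<close> pairs to zero under
      \<open>\<omega>\<close> with the kernel of \<open>t\<close>, only the term in which
      \<open>D\<close> hits \<open>J e\<close> survives, and it equals the product of the squared
      norms of \<open>v\<close> and \<open>y\<close>.\<close>
    obtain y where y: "y \<in> n1" "y \<noteq> 0" "g v y = 0" "g (J v) y = 0"
      using n1_ex by blast
    have "\<omega> (J e) z = 0" if "t z = 0" for z
      using that by (simp add: \<omega>_def J g_simps ge)
    then have z: "\<omega> z (J e) = 0" "\<omega> (J e) z = 0" if "t z = 0" for z
      using that \<omega>_skew[of z "J e"] by simp_all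
    have tt: "t (J v) = 0" "t y = 0" "t (J y) = 0" "t v = 0"
      using v y by (auto simp: n1_def)
    have De: "D (J e) = a *\<^sub>R J e + v"
      by (simp add: v_def)
    have "E (D (J e)) (J v) y (J y) = 0"
      using balE[OF tJe tt(1-3)] by (simp add: E_def z tt D(2))
    then have "E v (J v) y (J y) = 0"
      using z[OF tt(1)] z[OF tt(2)] z[OF tt(3)]
      by (simp add: E_def De \<omega>_def lin g_simps)
    moreover have "E v (J v) y (J y) = g v v * g y y"
      using y(3,4) gJl[of v y] by (simp add: E_def \<omega>_def gJJ)
    ultimately show False
      using pos[OF v(1)] pos[OF y(2)] by simp
  qed

  \<comment> \<open>\<open>x\<close>, \<open>J x\<close>, \<open>y\<close>, \<open>J y\<close>
    become an orthogonal basis of \<open>n1\<close>; the vectors are not normalised, so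
    \<open>g x x\<close> and \<open>g y y\<close> remain as positive factors.\<close>
  obtain x where x: "x \<in> n1" "x \<noteq> 0"
    using n1_ex by blast
  obtain y where y: "y \<in> n1" "y \<noteq> 0" "g x y = 0" "g (J x) y = 0"
    using n1_ex by blast
  have gx: "g x x > 0" and gy: "g y y > 0"
    using pos x y by blast+
  define \<phi> where "\<phi> = (\<lambda>(r, X, s). r *\<^sub>R J e + Re (fst X) *\<^sub>R x + Im (fst X) *\<^sub>R J x
    + Re (snd X) *\<^sub>R y + Im (snd X) *\<^sub>R J y + s *\<^sub>R e)"
  have \<phi>_lin: "linear \<phi>"
    by (rule linearI) (auto simp: \<phi>_def algebra_simps)
  have tx: "t x = 0" "t (J x) = 0" "t y = 0" "t (J y) = 0"
    using x y by (auto simp: n1_def)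
  have orth: "g x (J x) = 0" "g x y = 0" "g x (J y) = 0" "g (J x) y = 0" "g (J x) (J y) = 0"
    "g y (J y) = 0"  "g e x = 0" "g e (J x) = 0" "g e y = 0" "g e (J y) = 0" "g (J e) x = 0"
    "g (J e) (J x) = 0" "g (J e) y = 0" "g (J e) (J y) = 0" "g e (J e) = 0"
    using y(3,4) gJl[of x y] tx tJe by (simp_all add: gJJ gJ0 ge gJe)
  note orth' = orth orth[THEN trans[OF sym]]
  have "X = 0" if "\<phi> X = 0" for X
  proof -
    obtain r z w s where X: "X = (r, (z, w), s)"
      by (metis prod.exhaust)
    have "g (\<phi> X) b = 0" for b
      using that by (simp add: g_simps)
    then have "g (\<phi> X) e = 0" "g (\<phi> X) (J e) = 0" "g (\<phi> X) x = 0" "g (\<phi> X) (J x) = 0"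
      "g (\<phi> X) y = 0" "g (\<phi> X) (J y) = 0"
      by blast+
    then show "X = 0"
      using gx gy gee unfolding X \<phi>_def
      by (simp add: g_simps orth' gJJ zero_prod_def complex_eq_iff)
  qed
  then have "inj \<phi>"
    by (simp add: linear_injective_0[OF \<phi>_lin])
  then have "surj \<phi>"
    using \<phi>_lin by (intro linear_injective_imp_surjective) (simp_all add: dim)

  have n1_\<phi>: "\<exists>z w. v = \<phi> (0, (z, w), 0)" if "v \<in> n1" for v
  proof -
    obtain r z w s where v: "v = \<phi> (r, (z, w), s)"
      using \<open>surj \<phi>\<close> by (metis surjD prod.exhaust)
    have "s = 0" "r = 0"
      using that by (simp_all add: v \<phi>_def n1_def lin tx te tJe J)
    then show ?thesis
      using v by blast
  qed
  obtain m11 m21 where Dx: "D x = \<phi> (0, (m11, m21), 0)"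
    using n1_\<phi> n1D(2)[OF x(1)] by blast
  obtain m12 m22 where Dy: "D y = \<phi> (0, (m12, m22), 0)"
    using n1_\<phi> n1D(2)[OF y(1)] by blast
  have DJx: "D (J x) = J (D x)" and DJy: "D (J y) = J (D y)"
    using n1D(1) x y by blast+
  \<comment> \<open>Nothing is known about \<open>D e\<close>; in the bracket it carries the
    coefficient \<open>s * s' - s' * s\<close> and cancels.\<close>
  have D\<phi>: "D (\<phi> (r, X, s)) = \<phi> (a * r, cx_mat m11 m12 m21 m22 X, 0) + s *\<^sub>R D e" for r X s
    by (simp add: \<phi>_def cx_mat_def lin De1 DJx DJy Dx Dy J algebra_simps)

  have "Re m11 + Re m22 = 0"
  proof -
    have 1: "g (D x) x = Re m11 * g x x" "g (D y) y = Re m22 * g y y"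
      by (simp_all add: Dx Dy \<phi>_def g_simps orth')
    have \<omega>: "\<omega> x (J x) = g x x" "\<omega> y (J y) = g y y" "\<omega> x y = 0" "\<omega> x (J y) = 0"
      "\<omega> (J x) y = 0" "\<omega> (J x) (J y) = 0"
      by (simp_all add: \<omega>_def gJJ orth' J g_simps)
    have \<omega>D: "\<omega> (D x) (J x) = g (D x) x" "\<omega> (D y) (J y) = g (D y) y"
      "\<omega> (J (D x)) x = - g (D x) x" "\<omega> (J (D y)) y = - g (D y) y"
      by (simp_all add: \<omega>_def gJJ J g_simps)
    \<comment> \<open>The balanced condition on \<open>x\<close>, \<open>J x\<close>,
      \<open>y\<close>, \<open>J y\<close>. By complex linearity of \<open>D\<close>, each vector
      and its image under \<open>J\<close> contribute equally, hence the factor 2.\<close>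
    have "2 * (g (D x) x * g y y + g x x * g (D y) y) = 0"
      using balE[OF tx] unfolding E_def DJx DJy \<omega>D \<omega> by (simp add: algebra_simps)
    then have "(Re m11 + Re m22) * (g x x * g y y) = 0"
      unfolding 1 by (simp add: algebra_simps)
    then show ?thesis
      using gx gy by simp
  qed
  moreover have "\<phi> (cx_alg a m11 m12 m21 m22 X Y) = br (\<phi> X) (\<phi> Y)" for X Y
  proof -
    obtain r z s r' z' s' where X: "X = (r, z, s)" "Y = (r', z', s')"
      by (metis prod.exhaust)
    have eq: "cx_alg a m11 m12 m21 m22 X Y = s *\<^sub>R (a * r', cx_mat m11 m12 m21 m22 z', 0)
        - s' *\<^sub>R (a * r, cx_mat m11 m12 m21 m22 z, 0)"
      by (simp add: X cx_mat_def scaleR_conv_of_real algebra_simps)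
    have t\<phi>: "t (\<phi> (r, z, s)) = s" for r z s
      by (simp add: \<phi>_def lin tx te tJe)
    show ?thesis
      unfolding eq br_def linear_diff[OF \<phi>_lin] linear_scale[OF \<phi>_lin]
      unfolding X t\<phi> D\<phi> by (simp add: scaleR_add_right mult.commute)
  qed
  ultimately show ?thesis
    using that \<phi>_lin \<open>inj \<phi>\<close> \<open>surj \<phi>\<close> unfolding lie_isomorphic_def bij_def by blast
qed

section \<open>Normal forms\<close>

lemma lie_isomorphic_refl: "lie_isomorphic br br"
  unfolding lie_isomorphic_def by (intro exI[of _ id]) (auto intro: linear_id)

text \<open>The four equations are the entries of M P = P N with P invertible, so P acting on the
  complex plane intertwines the two actions.\<close>

lemma cx_alg_similar:
  assumes det: "p11 * p22 - p12 * p21 \<noteq> 0"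
    and "m11 * p11 + m12 * p21 = p11 * n11 + p12 * n21" "m11 * p12 + m12 * p22 = p11 * n12 + p12 * n22"
      "m21 * p11 + m22 * p21 = p21 * n11 + p22 * n21" "m21 * p12 + m22 * p22 = p21 * n12 + p22 * n22"
  shows "lie_isomorphic (cx_alg a n11 n12 n21 n22) (cx_alg a m11 m12 m21 m22)"
proof -
  define \<phi> where "\<phi> = (\<lambda>(x, X, t). (x, cx_mat p11 p12 p21 p22 X, t) :: cx_space)"
  have lin: "linear \<phi>"
    by (rule linearI) (auto simp: \<phi>_def cx_mat_def scaleR_conv_of_real algebra_simps)
  have "X = 0" if "\<phi> X = 0" for X
  proof -
    obtain x z w t where X: "X = (x, (z, w), t)"
      by (metis prod.exhaust)
    have "p11 * z + p12 * w = 0" "p21 * z + p22 * w = 0"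
      using that by (simp_all add: X \<phi>_def cx_mat_def zero_prod_def)
    then have "(p11 * p22 - p12 * p21) * z = 0" "(p11 * p22 - p12 * p21) * w = 0"
      by algebra+
    then show "X = 0"
      using that det by (simp add: X \<phi>_def zero_prod_def)
  qed
  then have "inj \<phi>"
    by (simp add: linear_injective_0[OF lin])
  moreover have "surj \<phi>"
    using lin \<open>inj \<phi>\<close> by (rule linear_injective_imp_surjective) simp
  moreover have "cx_mat p11 p12 p21 p22 (cx_mat n11 n12 n21 n22 X) =
      cx_mat m11 m12 m21 m22 (cx_mat p11 p12 p21 p22 X)" for X
    unfolding cx_mat_def prod.inject fst_conv snd_conv using assms(2-5) by algebra
  then have "\<phi> (cx_alg a n11 n12 n21 n22 X Y) = cx_alg a m11 m12 m21 m22 (\<phi> X) (\<phi> Y)" for X Y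
    by (cases X; cases Y) (simp add: \<phi>_def, simp add: cx_mat_def scaleR_conv_of_real algebra_simps)
  ultimately show ?thesis
    using lin unfolding lie_isomorphic_def bij_def by blast
qed

text \<open>Rescaling the acting coordinate multiplies its whole action on the ideal by
  \<open>k\<close>.\<close>

lemma cx_alg_scale:
  assumes "k \<noteq> 0"
  shows "lie_isomorphic (cx_alg (k * a) (k *\<^sub>R m11) (k *\<^sub>R m12) (k *\<^sub>R m21) (k *\<^sub>R m22))
    (cx_alg a m11 m12 m21 m22)"
  unfolding lie_isomorphic_def
proof (intro exI conjI allI)
  let ?\<phi> = "\<lambda>(x, X, t). (x, X, k * t) :: cx_space"
  show "linear ?\<phi>"
    by (rule linearI) (auto simp: algebra_simps)
  show "bij ?\<phi>"
    by (rule o_bij[of "\<lambda>(x, X, t). (x, X, t / k)"]) (use assms in \<open>auto simp: fun_eq_iff\<close>)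
  show "?\<phi> (cx_alg (k * a) (k *\<^sub>R m11) (k *\<^sub>R m12) (k *\<^sub>R m21) (k *\<^sub>R m22) X Y) =
      cx_alg a m11 m12 m21 m22 (?\<phi> X) (?\<phi> Y)" for X Y
    by (cases X; cases Y) (simp add: cx_mat_def scaleR_conv_of_real algebra_simps)
qed

text \<open>A matrix that is not already diagonal is not scalar. Its eigenvalues, given by the
  quadratic formula, are then either distinct, and it is diagonalisable, or equal, and it is similar
  to a single Jordan block.\<close>

lemma cx_alg_normal_form:
  obtains l1 l2 where "l1 + l2 = m11 + m22"
    "lie_isomorphic (cx_alg a l1 0 0 l2) (cx_alg a m11 m12 m21 m22) \<or>
     l1 = l2 \<and> (\<forall>c. c \<noteq> 0 \<longrightarrow> lie_isomorphic (cx_alg a l1 c 0 l1) (cx_alg a m11 m12 m21 m22))"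
proof (cases "m12 = 0 \<and> m21 = 0")
  case True
  then show ?thesis
    using that[of m11 m22] lie_isomorphic_refl by blast
next
  case False
  define d where "d = csqrt (((m11 + m22) / 2)\<^sup>2 - (m11 * m22 - m12 * m21))"
  define l1 l2 where "l1 = (m11 + m22) / 2 + d" and "l2 = (m11 + m22) / 2 - d"
  have tr: "l1 + l2 = m11 + m22"
    by (simp add: l1_def l2_def field_simps)
  have "l1 * l2 = ((m11 + m22) / 2)\<^sup>2 - d\<^sup>2"
    by (simp add: l1_def l2_def power2_eq_square algebra_simps)
  then have det: "l1 * l2 = m11 * m22 - m12 * m21"
    by (simp add: d_def)
  \<comment> \<open>By Cayley--Hamilton the columns of \<open>M - l2\<close> are eigenvectors for \<open>l1\<close>, and conversely.\<close>
  have "lie_isomorphic (cx_alg a l1 0 0 l2) (cx_alg a m11 m12 m21 m22)" if "l1 \<noteq> l2"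
  proof (cases "m21 = 0")
    case False
    \<comment> \<open>The determinant claim fixes the matrix P by its shape: the columns of P are
      the first columns of \<open>M - l2\<close> and \<open>M - l1\<close>. For
      \<open>m21 = 0\<close> the second columns are used.\<close>
    show ?thesis
    proof (rule cx_alg_similar)
      have "(m11 - l2) * m21 - (m11 - l1) * m21 = (l1 - l2) * m21"
        by (simp add: algebra_simps)
      then show "(m11 - l2) * m21 - (m11 - l1) * m21 \<noteq> 0"
        using that False by simp
    qed (use tr det in algebra)+
  next
    case True
    show ?thesis
    proof (rule cx_alg_similar)
      have "m12 * (m22 - l1) - m12 * (m22 - l2) = (l2 - l1) * m12"
        by (simp add: algebra_simps)
      then show "m12 * (m22 - l1) - m12 * (m22 - l2) \<noteq> 0"
        using that True False by simp
    qed (use tr det in algebra)+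
  qed
  \<comment> \<open>The Jordan basis is \<open>(M - l1) v / c\<close>, \<open>v\<close>, where
    \<open>v\<close> is the first standard vector if \<open>m21\<close> is nonzero and the second
    otherwise. The choice of \<open>c\<close> only rescales the eigenvector.\<close>
  moreover have "lie_isomorphic (cx_alg a l1 c 0 l1) (cx_alg a m11 m12 m21 m22)"
    if "l1 = l2" "c \<noteq> 0" for c
  proof (cases "m21 = 0")
    case False
    show ?thesis
    proof (rule cx_alg_similar)
      show "((m11 - l1) / c) * 0 - 1 * (m21 / c) \<noteq> 0"
        using that False by simp
    qed (use tr det that in \<open>simp_all add: field_simps, algebra+\<close>)
  next
    case True
    show ?thesis
    proof (rule cx_alg_similar)
      show "(m12 / c) * 1 - 0 * ((m22 - l1) / c) \<noteq> 0"
        using that True False by simp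
    qed (use tr det that in \<open>simp_all add: field_simps, algebra+\<close>)
  qed
  ultimately show ?thesis
    using that tr by blast
qed

lemma cx_alg_swap: "lie_isomorphic (cx_alg a l2 0 0 l1) (cx_alg a l1 0 0 l2)"
  by (rule cx_alg_similar[of 0 0 1 1]) simp_all

section \<open>Identification of the models with the listed algebras\<close>

lemma coordinates_isomorphic:
  fixes \<phi> :: "cx_space \<Rightarrow> real^6"
  assumes "linear \<phi>" "\<And>X. \<phi> X = 0 \<Longrightarrow> X = 0" "\<And>X Y. \<phi> (br X Y) = br' (\<phi> X) (\<phi> Y)"
  shows "lie_isomorphic br br'"
proof -
  have "inj \<phi>"
    using assms(2) by (simp add: linear_injective_0[OF assms(1)])
  moreover have "surj \<phi>"
    using assms(1) \<open>inj \<phi>\<close> by (rule linear_injective_imp_surjective) simp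
  ultimately show ?thesis
    using assms unfolding lie_isomorphic_def bij_def by blast
qed

text \<open>Ordering for \<open>alg_b1\<close>, \<open>alg_b3\<close>, \<open>alg_b4\<close> and
  \<open>alg_b5\<close>: the real line of the ideal comes first, followed by the two complex
  coordinates.\<close>

lemma coordinates_isomorphic_1:
  fixes \<phi> defines "\<phi> \<equiv> \<lambda>(x, X, t).
    vector [x, Re (fst X), Im (fst X), Re (snd X), Im (snd X), t] :: real^6"
  assumes "\<And>X Y. \<phi> (br X Y) = br' (\<phi> X) (\<phi> Y)"
  shows "lie_isomorphic br br'"
proof (rule coordinates_isomorphic[where \<phi> = \<phi> and br = br and br' = br', OF _ _ assms(2)])
  show "linear \<phi>"
    by (rule linearI; clarsimp simp: \<phi>_def vec_eq_iff forall_6 vector_6)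
  show "X = 0" if "\<phi> X = 0" for X
    using that
    by (cases X) (clarsimp simp: \<phi>_def vec_eq_iff forall_6 vector_6 zero_prod_def prod_eq_iff complex_eq_iff)
qed

text \<open>Ordering for \<open>alg_b6\<close> to \<open>alg_b9\<close>: there \<open>a = 0\<close>,
  and the real line is the central fifth direction.\<close>

lemma coordinates_isomorphic_2:
  fixes \<phi> defines "\<phi> \<equiv> \<lambda>(x, X, t).
    vector [Re (fst X), Im (fst X), Re (snd X), Im (snd X), x, t] :: real^6"
  assumes "\<And>X Y. \<phi> (br X Y) = br' (\<phi> X) (\<phi> Y)"
  shows "lie_isomorphic br br'"
proof (rule coordinates_isomorphic[where \<phi> = \<phi> and br = br and br' = br', OF _ _ assms(2)])
  show "linear \<phi>"
    by (rule linearI; clarsimp simp: \<phi>_def vec_eq_iff forall_6 vector_6)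
  show "X = 0" if "\<phi> X = 0" for X
    using that
    by (cases X) (clarsimp simp: \<phi>_def vec_eq_iff forall_6 vector_6 zero_prod_def prod_eq_iff complex_eq_iff)
qed

text \<open>Ordering for \<open>alg_b2\<close>: its real Jordan block separates real from imaginary
  parts, which are therefore grouped.\<close>

lemma coordinates_isomorphic_3:
  fixes \<phi> defines "\<phi> \<equiv> \<lambda>(x, X, t).
    vector [x, Re (fst X), Re (snd X), Im (fst X), Im (snd X), t] :: real^6"
  assumes "\<And>X Y. \<phi> (br X Y) = br' (\<phi> X) (\<phi> Y)"
  shows "lie_isomorphic br br'"
proof (rule coordinates_isomorphic[where \<phi> = \<phi> and br = br and br' = br', OF _ _ assms(2)])
  show "linear \<phi>"
    by (rule linearI; clarsimp simp: \<phi>_def vec_eq_iff forall_6 vector_6)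
  show "X = 0" if "\<phi> X = 0" for X
    using that
    by (cases X) (clarsimp simp: \<phi>_def vec_eq_iff forall_6 vector_6 zero_prod_def prod_eq_iff complex_eq_iff)
qed

lemmas alg_b_defs = alg_b1_def alg_b2_def alg_b3_def alg_b4_def alg_b5_def alg_b6_def alg_b7_def
  alg_b8_def alg_b9_def

text \<open>With the sign in \<open>df(X, Y) = - f([X, Y])\<close>, a term \<open>f k 6\<close>
  contributes the \<open>k\<close>-th coordinate with positive sign to the action of the sixth basis
  vector. Thus the pair \<open>q * f 2 6 + f 3 6\<close>, \<open>- f 2 6 + q * f 3 6\<close> is
  multiplication by q - i.\<close>

lemma cx_alg_b:
  shows "lie_isomorphic (cx_alg 1 (Complex p 0) 0 0 (Complex (- p) 0)) (alg_b1 p)"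
    "lie_isomorphic (cx_alg p (Complex q 0) 0 0 (Complex (- q) (- 1))) (alg_b3 p q)"
    "lie_isomorphic (cx_alg p (Complex q (- 1)) 0 0 (Complex (- q) (- s))) (alg_b4 p q s)"
    "lie_isomorphic (cx_alg p (- \<i>) (- 1) 0 (- \<i>)) (alg_b5 p)"
  by (rule coordinates_isomorphic_1;
      clarsimp simp: alg_b_defs lie_of_eqs_eq vec_eq_iff forall_6 vector_6 cx_mat_def algebra_simps)+

lemma cx_alg_b':
  shows "lie_isomorphic (cx_alg 0 1 0 0 (- 1)) alg_b6"
    "lie_isomorphic (cx_alg 0 1 0 0 (Complex (- 1) (- r))) (alg_b7 r)"
    "lie_isomorphic (cx_alg 0 (Complex p (- 1)) 0 0 (Complex (- p) (- r))) (alg_b8 p r)"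
    "lie_isomorphic (cx_alg 0 (- \<i>) (- 1) 0 (- \<i>)) alg_b9"
  by (rule coordinates_isomorphic_2;
      clarsimp simp: alg_b_defs lie_of_eqs_eq vec_eq_iff forall_6 vector_6 cx_mat_def algebra_simps)+

lemma cx_alg_b2: "lie_isomorphic (cx_alg 1 0 1 0 0) alg_b2"
  by (rule coordinates_isomorphic_3;
      clarsimp simp: alg_b_defs lie_of_eqs_eq vec_eq_iff forall_6 vector_6 cx_mat_def algebra_simps)

section \<open>Traces and unimodularity\<close>

lemma trace_6:
  "trace (A :: real^6^6) = A $ 1 $ 1 + A $ 2 $ 2 + A $ 3 $ 3 + A $ 4 $ 4 + A $ 5 $ 5 + A $ 6 $ 6"
proof -
  have "(UNIV :: 6 set) = {1, 2, 3, 4, 5, 6}"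
    using forall_6[of "\<lambda>i. i \<in> {1, 2, 3, 4, 5, 6}"] by auto
  then have "trace A = (\<Sum>i\<in>{1, 2, 3, 4, 5, 6}. A $ i $ i)"
    unfolding trace_def by (simp only:)
  also have "\<dots> = A $ 1 $ 1 + A $ 2 $ 2 + A $ 3 $ 3 + A $ 4 $ 4 + A $ 5 $ 5 + A $ 6 $ 6"
    by (simp add: add.assoc)
  finally show ?thesis .
qed

text \<open>The trace is the sixth coordinate times \<open>a\<close> plus twice the real trace of
  the complex matrix; the latter is zero, so only \<open>a\<close> remains.\<close>

lemma trace_alg_b:
  "trace (matrix (alg_b1 p x)) = x $ 6"
  "trace (matrix (alg_b2 x)) = x $ 6"
  "trace (matrix (alg_b3 p q x)) = p * x $ 6"
  "trace (matrix (alg_b4 p q s x)) = p * x $ 6"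
  "trace (matrix (alg_b5 p x)) = p * x $ 6"
  "trace (matrix (alg_b6 x)) = 0"
  "trace (matrix (alg_b7 r x)) = 0"
  "trace (matrix (alg_b8 p r x)) = 0"
  "trace (matrix (alg_b9 x)) = 0"
  by (simp_all add: trace_6 matrix_def alg_b_defs lie_of_eqs_eq vector_6 axis_def algebra_simps)

lemma unimodular_alg_b:
  shows "\<not> unimodular (alg_b1 p)" "\<not> unimodular alg_b2"
    "p \<noteq> 0 \<Longrightarrow> \<not> unimodular (alg_b3 p q)" "p \<noteq> 0 \<Longrightarrow> \<not> unimodular (alg_b4 p q s)"
    "p \<noteq> 0 \<Longrightarrow> \<not> unimodular (alg_b5 p)" "unimodular alg_b6" "unimodular (alg_b7 r)"
    "unimodular (alg_b8 p r)" "unimodular alg_b9"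
  unfolding unimodular_def trace_alg_b by (auto intro: exI[of _ "axis 6 1"])

lemma balanced_alg_b:
  "\<exists>J g. balanced_structure (alg_b1 p) J g"
  "\<exists>J g. balanced_structure alg_b2 J g"
  "\<exists>J g. balanced_structure (alg_b3 p q) J g"
  "\<exists>J g. balanced_structure (alg_b4 p q s) J g"
  "\<exists>J g. balanced_structure (alg_b5 p) J g"
  "\<exists>J g. balanced_structure alg_b6 J g"
  "\<exists>J g. balanced_structure (alg_b7 r) J g"
  "\<exists>J g. balanced_structure (alg_b8 p r) J g"
  "\<exists>J g. balanced_structure alg_b9 J g"
  by (rule balanced_lie_isomorphic[OF lie_isomorphic_sym balanced_cx_alg],
      rule cx_alg_b cx_alg_b' cx_alg_b2, simp)+

section \<open>Sorting the normal forms into the list\<close>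

definition is_alg_b :: "('a::real_vector \<Rightarrow> 'a \<Rightarrow> 'a) \<Rightarrow> bool" where
  "is_alg_b br \<longleftrightarrow>
    (\<exists>p. p \<noteq> 0 \<and> lie_isomorphic br (alg_b1 p)) \<or>
    lie_isomorphic br alg_b2 \<or>
    (\<exists>p q. p * q \<noteq> 0 \<and> lie_isomorphic br (alg_b3 p q)) \<or>
    (\<exists>p q s. p * q * s \<noteq> 0 \<and> lie_isomorphic br (alg_b4 p q s)) \<or>
    (\<exists>p. p \<noteq> 0 \<and> lie_isomorphic br (alg_b5 p)) \<or>
    lie_isomorphic br alg_b6 \<or>
    (\<exists>r. r \<noteq> 0 \<and> lie_isomorphic br (alg_b7 r)) \<or>
    (\<exists>p r. p * r \<noteq> 0 \<and> lie_isomorphic br (alg_b8 p r)) \<or>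
    lie_isomorphic br alg_b9"

lemma is_alg_bI:
  "lie_isomorphic br (alg_b1 p) \<Longrightarrow> p \<noteq> 0 \<Longrightarrow> is_alg_b br"
  "lie_isomorphic br alg_b2 \<Longrightarrow> is_alg_b br"
  "lie_isomorphic br (alg_b3 p q) \<Longrightarrow> p * q \<noteq> 0 \<Longrightarrow> is_alg_b br"
  "lie_isomorphic br (alg_b4 p q s) \<Longrightarrow> p * q * s \<noteq> 0 \<Longrightarrow> is_alg_b br"
  "lie_isomorphic br (alg_b5 p) \<Longrightarrow> p \<noteq> 0 \<Longrightarrow> is_alg_b br"
  "lie_isomorphic br alg_b6 \<Longrightarrow> is_alg_b br"
  "lie_isomorphic br (alg_b7 r) \<Longrightarrow> r \<noteq> 0 \<Longrightarrow> is_alg_b br"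
  "lie_isomorphic br (alg_b8 p r) \<Longrightarrow> p * r \<noteq> 0 \<Longrightarrow> is_alg_b br"
  "lie_isomorphic br alg_b9 \<Longrightarrow> is_alg_b br"
  unfolding is_alg_b_def by blast+

lemma is_alg_b_lie_isomorphic:
  assumes "lie_isomorphic br br'" "is_alg_b br'" shows "is_alg_b br"
  using assms(2) lie_isomorphic_trans[OF assms(1)] unfolding is_alg_b_def by blast

lemma is_alg_b_imp_balanced:
  assumes "is_alg_b br" shows "\<exists>J g. balanced_structure br J g"
  using assms unfolding is_alg_b_def
  by (elim disjE exE conjE) (metis balanced_lie_isomorphic balanced_alg_b)+

lemma is_alg_b_scale:
  assumes "k \<noteq> 0" "is_alg_b (cx_alg (k * a) (k *\<^sub>R m11) (k *\<^sub>R m12) (k *\<^sub>R m21) (k *\<^sub>R m22))"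
  shows "is_alg_b (cx_alg a m11 m12 m21 m22)"
  using assms is_alg_b_lie_isomorphic lie_isomorphic_sym cx_alg_scale by blast

lemma scaleR_Complex: "k *\<^sub>R Complex x y = Complex (k * x) (k * y)"
  by (simp add: complex_eq_iff)

lemma is_alg_b_diagonal:
  assumes "q \<noteq> 0"
  shows "is_alg_b (cx_alg a (Complex q s1) 0 0 (Complex (- q) s2))"
proof -
  \<comment> \<open>The remaining case, \<open>s2 = 0\<close> with \<open>s1\<close> nonzero,
    reduces to this one by exchanging the eigenvalues, which replaces \<open>q\<close> by
    \<open>- q\<close>; hence the statement for every nonzero \<open>q\<close>.\<close>
  have 1: "is_alg_b (cx_alg a (Complex q s1) 0 0 (Complex (- q) s2))"
    if q: "q \<noteq> 0" and s: "s1 = 0 \<or> s2 \<noteq> 0" for q s1 s2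
  proof -
    \<comment> \<open>The cases give \<open>alg_b1\<close>, \<open>alg_b3\<close>,
      \<open>alg_b4\<close>, \<open>alg_b6\<close>, \<open>alg_b7\<close>, \<open>alg_b8\<close> in
      this order. The scalar \<open>?k\<close> normalises, respectively, \<open>a\<close> to 1,
      \<open>s2\<close> to -1, \<open>s1\<close> to -1, \<open>q\<close> to 1 twice, and
      \<open>s1\<close> to -1.\<close>
    consider "a \<noteq> 0" "s1 = 0" "s2 = 0" | "a \<noteq> 0" "s1 = 0" "s2 \<noteq> 0" | "a \<noteq> 0" "s1 \<noteq> 0" "s2 \<noteq> 0" |
      "a = 0" "s1 = 0" "s2 = 0" | "a = 0" "s1 = 0" "s2 \<noteq> 0" | "a = 0" "s1 \<noteq> 0" "s2 \<noteq> 0"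
      using s by blast
    then show ?thesis
    proof cases
      case 1
      let ?k = "inverse a"
      have iso: "lie_isomorphic (cx_alg (?k * a) (?k *\<^sub>R Complex q s1) (?k *\<^sub>R 0)
          (?k *\<^sub>R 0) (?k *\<^sub>R Complex (- q) s2)) (alg_b1 (?k * q))"
        using cx_alg_b(1)[of "?k * q"] 1 q by (simp add: scaleR_Complex)
      have "?k \<noteq> 0" "?k * q \<noteq> 0"
        using 1 q by simp_all
      then show ?thesis
        using is_alg_b_scale is_alg_bI(1)[OF iso] by blast
    next
      case 2
      let ?k = "- inverse s2"
      have iso: "lie_isomorphic (cx_alg (?k * a) (?k *\<^sub>R Complex q s1) (?k *\<^sub>R 0)
          (?k *\<^sub>R 0) (?k *\<^sub>R Complex (- q) s2)) (alg_b3 (?k * a) (?k * q))"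
        using cx_alg_b(2)[of "?k * a" "?k * q"] 2 q by (simp add: scaleR_Complex)
      have "?k \<noteq> 0" "(?k * a) * (?k * q) \<noteq> 0"
        using 2 q by simp_all
      then show ?thesis
        using is_alg_b_scale is_alg_bI(3)[OF iso] by blast
    next
      case 3
      let ?k = "- inverse s1"
      have iso: "lie_isomorphic (cx_alg (?k * a) (?k *\<^sub>R Complex q s1) (?k *\<^sub>R 0)
          (?k *\<^sub>R 0) (?k *\<^sub>R Complex (- q) s2)) (alg_b4 (?k * a) (?k * q) (- ?k * s2))"
        using cx_alg_b(3)[of "?k * a" "?k * q" "- ?k * s2"] 3 q by (simp add: scaleR_Complex)
      have "?k \<noteq> 0" "(?k * a) * (?k * q) * (- ?k * s2) \<noteq> 0"
        using 3 q by simp_all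
      then show ?thesis
        using is_alg_b_scale is_alg_bI(4)[OF iso] by blast
    next
      case 4
      let ?k = "inverse q"
      have iso: "lie_isomorphic (cx_alg (?k * a) (?k *\<^sub>R Complex q s1) (?k *\<^sub>R 0)
          (?k *\<^sub>R 0) (?k *\<^sub>R Complex (- q) s2)) alg_b6"
        using cx_alg_b'(1) 4 q by (simp add: scaleR_Complex one_complex.code[symmetric] uminus_complex.code)
      have "?k \<noteq> 0"
        using 4 q by simp
      then show ?thesis
        using is_alg_b_scale is_alg_bI(6)[OF iso] by blast
    next
      case 5
      let ?k = "inverse q"
      have iso: "lie_isomorphic (cx_alg (?k * a) (?k *\<^sub>R Complex q s1) (?k *\<^sub>R 0)
          (?k *\<^sub>R 0) (?k *\<^sub>R Complex (- q) s2)) (alg_b7 (- ?k * s2))"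
        using cx_alg_b'(2)[of "- ?k * s2"] 5 q by (simp add: scaleR_Complex one_complex.code[symmetric])
      have "?k \<noteq> 0" "- ?k * s2 \<noteq> 0"
        using 5 q by simp_all
      then show ?thesis
        using is_alg_b_scale is_alg_bI(7)[OF iso] by blast
    next
      case 6
      let ?k = "- inverse s1"
      have iso: "lie_isomorphic (cx_alg (?k * a) (?k *\<^sub>R Complex q s1) (?k *\<^sub>R 0)
          (?k *\<^sub>R 0) (?k *\<^sub>R Complex (- q) s2)) (alg_b8 (?k * q) (- ?k * s2))"
        using cx_alg_b'(3)[of "?k * q" "- ?k * s2"] 6 q by (simp add: scaleR_Complex)
      have "?k \<noteq> 0" "(?k * q) * (- ?k * s2) \<noteq> 0"
        using 6 q by simp_all
      then show ?thesis
        using is_alg_b_scale is_alg_bI(8)[OF iso] by blast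
    qed
  qed
  show ?thesis
  proof (cases "s1 = 0 \<or> s2 \<noteq> 0")
    case False
    have "is_alg_b (cx_alg a (Complex (- q) s2) 0 0 (Complex (- (- q)) s1))"
      using assms False by (intro 1) auto
    then show ?thesis
      using is_alg_b_lie_isomorphic cx_alg_swap by fastforce
  qed (use 1 assms in blast)
qed

text \<open>Conjugation makes the off-diagonal entry of a Jordan block arbitrary, so it suffices to treat
  one value.\<close>

lemma is_alg_b_jordan:
  assumes "a \<noteq> 0 \<or> s \<noteq> 0"
  obtains c where "c \<noteq> 0" "is_alg_b (cx_alg a (Complex 0 s) (of_real c) 0 (Complex 0 s))"
proof (cases "s = 0")
  case True
  let ?k = "inverse a"
  have "a \<noteq> 0" "?k \<noteq> 0"
    using True assms by simp_all
  have "cx_alg (?k * a) (?k *\<^sub>R Complex 0 s) (?k *\<^sub>R of_real a) (?k *\<^sub>R 0) (?k *\<^sub>R Complex 0 s) =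
      cx_alg 1 0 1 0 0"
    using True assms by (simp add: scaleR_conv_of_real zero_complex.code[symmetric])
  then have "is_alg_b (cx_alg a (Complex 0 s) (of_real a) 0 (Complex 0 s))"
    using is_alg_b_scale[OF \<open>?k \<noteq> 0\<close>] is_alg_bI(2)[OF cx_alg_b2] by metis
  then show ?thesis
    using that \<open>a \<noteq> 0\<close> by blast
next
  case False
  \<comment> \<open>Scaling turns the eigenvalue into -i and the off-diagonal entry, taken to be
    \<open>s\<close>, into -1, as in \<open>alg_b5\<close> and \<open>alg_b9\<close>.\<close>
  let ?k = "- inverse s"
  have "?k \<noteq> 0"
    using False by simp
  have eq: "cx_alg (?k * a) (?k *\<^sub>R Complex 0 s) (?k *\<^sub>R of_real s) (?k *\<^sub>R 0) (?k *\<^sub>R Complex 0 s) =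
      cx_alg (?k * a) (- \<i>) (- 1) 0 (- \<i>)"
  proof -
    have "?k *\<^sub>R Complex 0 s = - \<i>" "?k *\<^sub>R complex_of_real s = - 1"
      using False by (simp_all add: complex_eq_iff)
    then show ?thesis
      by (simp only: scaleR_zero_right)
  qed
  have "is_alg_b (cx_alg (?k * a) (- \<i>) (- 1) 0 (- \<i>))"
  proof (cases "a = 0")
    case True
    then show ?thesis
      using is_alg_bI(9)[OF cx_alg_b'(4)] by simp
  next
    case a: False
    then have "?k * a \<noteq> 0"
      using False by simp
    then show ?thesis
      by (rule is_alg_bI(5)[OF cx_alg_b(4)])
  qed
  then have "is_alg_b (cx_alg a (Complex 0 s) (of_real s) 0 (Complex 0 s))"
    using is_alg_b_scale[OF \<open>?k \<noteq> 0\<close>] eq by metis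
  then show ?thesis
    using that False by blast
qed

text \<open>The eigenvalues have opposite real parts. The diagonal case with nonzero real part leads
  to \<open>is_alg_b_diagonal\<close>, and zero real part would be Kaehler. A Jordan block has an
  imaginary eigenvalue, and this eigenvalue and \<open>a\<close> cannot both vanish, since the
  algebra would be nilpotent.\<close>

lemma cx_alg_classification:
  assumes tr: "Re m11 + Re m22 = 0"
    and nil: "\<not> nilpotent_lie (cx_alg a m11 m12 m21 m22)"
    and kah: "\<not> (\<exists>J g. kahler_structure (cx_alg a m11 m12 m21 m22) J g)"
  shows "is_alg_b (cx_alg a m11 m12 m21 m22)"
proof -
  let ?br = "cx_alg a m11 m12 m21 m22"
  obtain l1 l2 where l: "l1 + l2 = m11 + m22" and
    "lie_isomorphic (cx_alg a l1 0 0 l2) ?br \<or>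
      l1 = l2 \<and> (\<forall>c. c \<noteq> 0 \<longrightarrow> lie_isomorphic (cx_alg a l1 c 0 l1) ?br)"
    using cx_alg_normal_form by blast
  moreover have Re: "Re l1 + Re l2 = 0"
    using arg_cong[OF l, of Re] tr by simp
  ultimately consider
    (diag) "lie_isomorphic (cx_alg a l1 0 0 l2) ?br" |
    (jordan) "l1 = l2" "\<And>c. c \<noteq> 0 \<Longrightarrow> lie_isomorphic (cx_alg a l1 c 0 l1) ?br"
    by blast
  then show ?thesis
  proof cases
    case diag
    have l1: "l1 = Complex (Re l1) (Im l1)" and l2: "l2 = Complex (- Re l1) (Im l2)"
      using Re by (simp_all add: complex_eq_iff)
    have "Re l1 \<noteq> 0"
    proof
      assume "Re l1 = 0"
      then have "cx_alg a l1 0 0 l2 = cx_alg a (Complex 0 (Im l1)) 0 0 (Complex 0 (Im l2))"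
        using l1 l2 by simp
      then show False
        using kah kahler_lie_isomorphic[OF lie_isomorphic_sym[OF diag]] kahler_cx_alg by metis
    qed
    from is_alg_b_diagonal[OF this, of a "Im l1" "Im l2"] show ?thesis
      using is_alg_b_lie_isomorphic[OF lie_isomorphic_sym[OF diag]] l1 l2 by simp
  next
    case jordan
    then have l1: "l1 = Complex 0 (Im l1)"
      using Re by (simp add: complex_eq_iff)
    have "a \<noteq> 0 \<or> Im l1 \<noteq> 0"
    proof (rule ccontr)
      assume "\<not> (a \<noteq> 0 \<or> Im l1 \<noteq> 0)"
      then have "a = 0" "l1 = 0"
        using l1 by (auto simp: complex_eq_iff)
      then have "nilpotent_lie ?br"
        using nilpotent_lie_isomorphic[OF jordan(2)[of 1] ] nilpotent_cx_alg by simp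
      then show False
        using nil by blast
    qed
    then obtain c where "c \<noteq> 0" "is_alg_b (cx_alg a l1 (of_real c) 0 l1)"
      using is_alg_b_jordan[of a "Im l1"] l1 by metis
    then show ?thesis
      using is_alg_b_lie_isomorphic[OF lie_isomorphic_sym[OF jordan(2)[of "of_real c"]]] by simp
  qed
qed

text \<open>The balanced structure is carried to coordinates and yields a model. Being nilpotent or
  Kaehler is invariant under isomorphism, so the model is neither and the classification applies to
  it.\<close>

lemma balanced_imp_is_alg_b:
  fixes br :: "'a::real_vector \<Rightarrow> 'a \<Rightarrow> 'a"
  assumes br: "lie_algebra br" "dim (UNIV :: 'a set) = 6" "almost_abelian br"
    and nil: "\<not> nilpotent_lie br" and kah: "\<not> (\<exists>J g. kahler_structure br J g)"
    and bal: "balanced_structure br J g"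
  shows "is_alg_b br"
proof -
  obtain D where D: "linear D" "\<And>x. D x $ 6 = 0"
    "lie_isomorphic (\<lambda>x y :: real^6. x $ 6 *\<^sub>R D y - y $ 6 *\<^sub>R D x) br"
    using almost_abelian_coordinates[OF br(1,3,2)] by blast
  obtain J' g' where bal':
    "balanced_structure (\<lambda>x y :: real^6. x $ 6 *\<^sub>R D y - y $ 6 *\<^sub>R D x) J' g'"
    using balanced_lie_isomorphic[OF D(3) bal] by blast
  have "linear (\<lambda>x :: real^6. x $ 6)"
    by (rule linearI) simp_all
  note cx = balanced_imp_cx_alg[where u = "axis 6 1", OF D(1) _ this _ _ bal']
  have "\<exists>a m11 m12 m21 m22. Re m11 + Re m22 = 0 \<and> lie_isomorphic (cx_alg a m11 m12 m21 m22)
      (\<lambda>x y :: real^6. x $ 6 *\<^sub>R D y - y $ 6 *\<^sub>R D x)"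
    by (rule cx) (simp_all only: D(2), simp, simp, blast)
  then obtain a m11 m12 m21 m22 where m: "Re m11 + Re m22 = 0"
    "lie_isomorphic (cx_alg a m11 m12 m21 m22) (\<lambda>x y :: real^6. x $ 6 *\<^sub>R D y - y $ 6 *\<^sub>R D x)"
    by blast
  have iso: "lie_isomorphic (cx_alg a m11 m12 m21 m22) br"
    using lie_isomorphic_trans[OF m(2) D(3)] .
  have "is_alg_b (cx_alg a m11 m12 m21 m22)"
    using nil kah nilpotent_lie_isomorphic[OF iso] kahler_lie_isomorphic[OF lie_isomorphic_sym[OF iso]]
    by (intro cx_alg_classification m(1)) blast+
  then show ?thesis
    using is_alg_b_lie_isomorphic[OF lie_isomorphic_sym[OF iso]] by blast
qed

theorem theorem4p1:
  shows "(\<forall>br :: 'a::real_vector \<Rightarrow> 'a \<Rightarrow> 'a.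
      lie_algebra br \<and> dim (UNIV :: 'a set) = 6 \<and> \<not> nilpotent_lie br \<and> almost_abelian br \<and>
      \<not> (\<exists>J g. kahler_structure br J g) \<longrightarrow>
      ((\<exists>J g. balanced_structure br J g) \<longleftrightarrow>
        (\<exists>p. p \<noteq> 0 \<and> lie_isomorphic br (alg_b1 p)) \<or>
        lie_isomorphic br alg_b2 \<or>
        (\<exists>p q. p * q \<noteq> 0 \<and> lie_isomorphic br (alg_b3 p q)) \<or>
        (\<exists>p q s. p * q * s \<noteq> 0 \<and> lie_isomorphic br (alg_b4 p q s)) \<or>
        (\<exists>p. p \<noteq> 0 \<and> lie_isomorphic br (alg_b5 p)) \<or>
        lie_isomorphic br alg_b6 \<or>
        (\<exists>r. r \<noteq> 0 \<and> lie_isomorphic br (alg_b7 r)) \<or>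
        (\<exists>p r. p * r \<noteq> 0 \<and> lie_isomorphic br (alg_b8 p r)) \<or>
        lie_isomorphic br alg_b9)) \<and>
    (\<forall>p. p \<noteq> 0 \<longrightarrow> \<not> unimodular (alg_b1 p)) \<and>
    \<not> unimodular alg_b2 \<and>
    (\<forall>p q. p * q \<noteq> 0 \<longrightarrow> \<not> unimodular (alg_b3 p q)) \<and>
    (\<forall>p q s. p * q * s \<noteq> 0 \<longrightarrow> \<not> unimodular (alg_b4 p q s)) \<and>
    (\<forall>p. p \<noteq> 0 \<longrightarrow> \<not> unimodular (alg_b5 p)) \<and>
    unimodular alg_b6 \<and>
    (\<forall>r. r \<noteq> 0 \<longrightarrow> unimodular (alg_b7 r)) \<and>
    (\<forall>p r. p * r \<noteq> 0 \<longrightarrow> unimodular (alg_b8 p r)) \<and>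
    unimodular alg_b9"
  using is_alg_b_imp_balanced balanced_imp_is_alg_b unfolding is_alg_b_def[symmetric]
  by (auto simp: unimodular_alg_b)

end
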